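(* Let $A$ be a random matrix drawn from $\mathcal{A}^{m\times n}_k$ and let $b\ge 1$. Suppose $x'\in[0,1]^n$ maximizes $\sum_i c_i x_i$ subject to $A x\le b\cdot e^m$ and $x\in[0,1]^n$, with $OPT=\sum_i c_i x'_i$, where $e^m$ is the all-ones vector of length $m$. If $1=\max_i c_i$ and $c_i\ge 1/p$ for all $i$, for some $p\ge 1$, and $m\le \frac{n\log m}{k}$, then $x'$ can be rounded to $\hat{x}\in\{0,1\}^n$ in polynomial time such that with high probability \[ \|A\hat{x}\|_\infty\le b \quad\text{and}\quad \sum_i c_i\hat{x}_i\ge \Omega\!\left(\frac{OPT}{(\max(p\log m,\log^2 m))^{1/b}}\right). \]
   Context: $\mathcal{A}^{m\times n}_k$ denotes the family (distribution) of $m\times n$ $0$-$1$ matrices in which each row, independently, has exactly $k$ ones in columns chosen uniformly at random from $\{1,\dots,n\}$ and zeros elsewhere. *)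

theory Defs
  imports "HOL-Probability.Probability" "Jordan_Normal_Form.Matrix"
begin

unbundle no vec_syntax
unbundle no inner_syntax

section \<open>Random matrices and the packing linear program\<close>

definition row_pmf :: "nat \<Rightarrow> nat \<Rightarrow> nat set pmf" where
  "row_pmf n k = pmf_of_set {S. S \<subseteq> {..<n} \<and> card S = k}"

text \<open>The row supports are independent and uniform among the \<open>k\<close>-element sets of columns.
  For \<open>k > n\<close> there is no such set and \<open>row_pmf\<close> is meaningless, so \<open>k \<le> n\<close> has to be
  assumed wherever it is used.\<close>

definition random_matrix :: "nat \<Rightarrow> nat \<Rightarrow> nat \<Rightarrow> real mat pmf" where
  "random_matrix m n k =
     map_pmf (\<lambda>S. mat m n (\<lambda>(i, j). if j \<in> S i then 1 else 0))
       (Pi_pmf {..<m} {} (\<lambda>_. row_pmf n k))"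

definition all_ones :: "nat \<Rightarrow> real vec" where
  "all_ones m = vec m (\<lambda>_. 1)"

definition linf_norm :: "real vec \<Rightarrow> real" where
  "linf_norm v = Max (insert 0 ((\<lambda>i. \<bar>v $ i\<bar>) ` {..<dim_vec v}))"

definition lp_feasible :: "real mat \<Rightarrow> real \<Rightarrow> real vec \<Rightarrow> bool" where
  "lp_feasible A b x \<longleftrightarrow>
     x \<in> carrier_vec (dim_col A) \<and> set\<^sub>v x \<subseteq> {0..1} \<and>
     A *\<^sub>v x \<le> b \<cdot>\<^sub>v all_ones (dim_row A)"

definition lp_optimal :: "real mat \<Rightarrow> real \<Rightarrow> real vec \<Rightarrow> real vec \<Rightarrow> bool" where
  "lp_optimal A b c x \<longleftrightarrow>
     lp_feasible A b x \<and> (\<forall>y. lp_feasible A b y \<longrightarrow> c \<bullet> y \<le> c \<bullet> x)"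

section \<open>Randomized polynomial-time computation\<close>

text \<open>The machine is a structured random access machine with a natural-number memory (also used
  for addressing), a real memory, and a tape of fair coin tosses. Real arithmetic is restricted to
  addition, multiplication by rational constants of the program text, conversion from natural
  numbers, and comparison. There is no multiplication of two memory cells and no rounding of reals.
  Hence, on rational input, after \<open>t\<close> steps every cell holds a number whose bit length is
  polynomial in \<open>t\<close> and in the bit length of the input, so charging one unit per command, as done
  below, agrees with Turing machine time up to a polynomial; at the same time the machine accepts
  arbitrary real input. Expressions are evaluated within one step, since their size is bounded by
  that of the program.\<close>

type_synonym cell_name = string

datatype nexp =
    NConst nat
  | NCell cell_name nexp
  | NAdd nexp nexp
  | NSub nexp nexp

datatype rexp =
    RConst rat
  | RCell cell_name nexp nexp
  | RNat nexp
  | RAdd rexp rexp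
  | RScale rat rexp

datatype bexp =
    NLess nexp nexp
  | RLess rexp rexp
  | BNot bexp
  | BAnd bexp bexp

datatype com =
    Skip
  | NSet cell_name nexp nexp
  | RSet cell_name nexp nexp rexp
  | Flip cell_name nexp
  | Seq com com
  | Cond bexp com com
  | While bexp com

record state =
  nmem :: "cell_name \<Rightarrow> nat \<Rightarrow> nat"
  rmem :: "cell_name \<Rightarrow> nat \<Rightarrow> nat \<Rightarrow> real"
  coins :: "bool list"

fun nval :: "nexp \<Rightarrow> state \<Rightarrow> nat" where
  "nval (NConst a) s = a"
| "nval (NCell v e) s = nmem s v (nval e s)"
| "nval (NAdd e f) s = nval e s + nval f s"
| "nval (NSub e f) s = nval e s - nval f s"

fun rval :: "rexp \<Rightarrow> state \<Rightarrow> real" where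
  "rval (RConst q) s = of_rat q"
| "rval (RCell v e f) s = rmem s v (nval e s) (nval f s)"
| "rval (RNat e) s = real (nval e s)"
| "rval (RAdd e f) s = rval e s + rval f s"
| "rval (RScale q e) s = of_rat q * rval e s"

fun bval :: "bexp \<Rightarrow> state \<Rightarrow> bool" where
  "bval (NLess e f) s \<longleftrightarrow> nval e s < nval f s"
| "bval (RLess e f) s \<longleftrightarrow> rval e s < rval f s"
| "bval (BNot e) s \<longleftrightarrow> \<not> bval e s"
| "bval (BAnd e f) s \<longleftrightarrow> bval e s \<and> bval f s"

definition set_ncell :: "cell_name \<Rightarrow> nat \<Rightarrow> nat \<Rightarrow> state \<Rightarrow> state" where
  "set_ncell v i a s = s\<lparr>nmem := (nmem s)(v := (nmem s v)(i := a))\<rparr>"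

definition set_rcell :: "cell_name \<Rightarrow> nat \<Rightarrow> nat \<Rightarrow> real \<Rightarrow> state \<Rightarrow> state" where
  "set_rcell v i j a s =
     s\<lparr>rmem := (rmem s)(v := (rmem s v)(i := (rmem s v i)(j := a)))\<rparr>"

text \<open>\<open>exec P s t s'\<close>: started in \<open>s\<close>, the program \<open>P\<close> halts in \<open>s'\<close> after \<open>t\<close> steps.
  \<open>Flip\<close> is stuck on an exhausted tape.\<close>

inductive exec :: "com \<Rightarrow> state \<Rightarrow> nat \<Rightarrow> state \<Rightarrow> bool" where
  Skip: "exec Skip s 1 s"
| NSet: "exec (NSet v e f) s 1 (set_ncell v (nval e s) (nval f s) s)"
| RSet: "exec (RSet v e f g) s 1 (set_rcell v (nval e s) (nval f s) (rval g s) s)"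
| Flip: "coins s = w # ws \<Longrightarrow>
    exec (Flip v e) s 1 (set_ncell v (nval e s) (of_bool w) (s\<lparr>coins := ws\<rparr>))"
| Seq: "exec P s t s' \<Longrightarrow> exec Q s' u s'' \<Longrightarrow> exec (Seq P Q) s (t + u + 1) s''"
| CondTrue: "bval e s \<Longrightarrow> exec P s t s' \<Longrightarrow> exec (Cond e P Q) s (t + 1) s'"
| CondFalse: "\<not> bval e s \<Longrightarrow> exec Q s t s' \<Longrightarrow> exec (Cond e P Q) s (t + 1) s'"
| WhileFalse: "\<not> bval e s \<Longrightarrow> exec (While e P) s 1 s"
| WhileTrue: "bval e s \<Longrightarrow> exec P s t s' \<Longrightarrow> exec (While e P) s' u s'' \<Longrightarrow>
    exec (While e P) s (t + u + 1) s''"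

inductive_cases exec_SkipE: "exec Skip s t s'"
inductive_cases exec_NSetE: "exec (NSet v e f) s t s'"
inductive_cases exec_RSetE: "exec (RSet v e f g) s t s'"
inductive_cases exec_FlipE: "exec (Flip v e) s t s'"
inductive_cases exec_SeqE: "exec (Seq P Q) s t s'"
inductive_cases exec_CondE: "exec (Cond e P Q) s t s'"
inductive_cases exec_WhileE: "exec (While e P) s t s'"

lemma exec_deterministic:
  assumes "exec P s t s'" and "exec P s u s''"
  shows "t = u \<and> s' = s''"
  using assms
proof (induction arbitrary: u s'' rule: exec.induct)
  case Skip
  then show ?case by (auto elim: exec_SkipE)
next
  case NSet
  then show ?case by (auto elim: exec_NSetE)
next
  case RSet
  then show ?case by (auto elim: exec_RSetE)
next
  case Flip
  then show ?case by (auto elim: exec_FlipE)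
next
  case (Seq P s t s' Q r s1)
  from Seq.prems obtain t2 s2 r2 where u: "u = t2 + r2 + 1" and P: "exec P s t2 s2"
    and Q: "exec Q s2 r2 s''"
    by (auto elim: exec_SeqE)
  from Seq.IH(1)[OF P] Q have "exec Q s' r2 s''" by simp
  from Seq.IH(1)[OF P] Seq.IH(2)[OF this] u show ?case by simp
next
  case (CondTrue e s P t s' Q)
  from CondTrue.prems CondTrue.hyps(1) obtain t2 where "u = t2 + 1" and "exec P s t2 s''"
    by (auto elim: exec_CondE)
  with CondTrue.IH[of t2 s''] show ?case by simp
next
  case (CondFalse e s Q t s' P)
  from CondFalse.prems CondFalse.hyps(1) obtain t2 where "u = t2 + 1" and "exec Q s t2 s''"
    by (auto elim: exec_CondE)
  with CondFalse.IH[of t2 s''] show ?case by simp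
next
  case (WhileFalse e s P)
  then show ?case by (auto elim: exec_WhileE)
next
  case (WhileTrue e s P t s' r s1)
  from WhileTrue.prems WhileTrue.hyps(1) obtain t2 s2 r2 where u: "u = t2 + r2 + 1"
    and P: "exec P s t2 s2" and W: "exec (While e P) s2 r2 s''"
    by (auto elim: exec_WhileE)
  from WhileTrue.IH(1)[OF P] W have "exec (While e P) s' r2 s''" by simp
  from WhileTrue.IH(1)[OF P] WhileTrue.IH(2)[OF this] u show ?case by simp
qed

definition initial_state ::
    "real mat \<Rightarrow> real \<Rightarrow> real vec \<Rightarrow> real vec \<Rightarrow> bool list \<Rightarrow> state" where
  "initial_state A b c x w =
     \<lparr>nmem = (\<lambda>v i. if v = ''m'' \<and> i = 0 then dim_row A
                    else if v = ''n'' \<and> i = 0 then dim_col A else 0),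
      rmem = (\<lambda>v i j. if v = ''A'' \<and> i < dim_row A \<and> j < dim_col A then A $$ (i, j)
                      else if v = ''b'' \<and> i = 0 \<and> j = 0 then b
                      else if v = ''c'' \<and> i = 0 \<and> j < dim_vec c then c $ j
                      else if v = ''x'' \<and> i = 0 \<and> j < dim_vec x then x $ j else 0),
      coins = w\<rparr>"

text \<open>\<open>rounds P A b c x w t y\<close>: on input \<open>A\<close>, \<open>b\<close>, \<open>c\<close>, \<open>x\<close> and coin tosses \<open>w\<close>, the program
  halts after \<open>t\<close> steps with output vector \<open>y\<close>.\<close>

definition rounds ::
    "com \<Rightarrow> real mat \<Rightarrow> real \<Rightarrow> real vec \<Rightarrow> real vec \<Rightarrow> bool list \<Rightarrow> nat \<Rightarrow> real vec \<Rightarrow> bool" where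
  "rounds P A b c x w t y \<longleftrightarrow>
     (\<exists>s. exec P (initial_state A b c x w) t s \<and> y = vec (dim_col A) (\<lambda>j. rmem s ''y'' 0 j))"

definition polynomially_bounded :: "(nat \<Rightarrow> nat \<Rightarrow> nat) \<Rightarrow> bool" where
  "polynomially_bounded T \<longleftrightarrow> (\<exists>C d. \<forall>m n. T m n \<le> C * (m + n + 1) ^ d)"

text \<open>A step consumes at most one coin toss, so a tape of length \<open>T m n\<close> is never exhausted by
  a run of at most \<open>T m n\<close> steps.\<close>

definition rounding_in_time :: "com \<Rightarrow> (nat \<Rightarrow> nat \<Rightarrow> nat) \<Rightarrow> bool" where
  "rounding_in_time P T \<longleftrightarrow>
     (\<forall>m n A b c x w.
        A \<in> carrier_mat m n \<longrightarrow> c \<in> carrier_vec n \<longrightarrow> x \<in> carrier_vec n \<longrightarrow> length w = T m n \<longrightarrow>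
        (\<exists>t y. rounds P A b c x w t y \<and> t \<le> T m n \<and> set\<^sub>v y \<subseteq> {0, 1}))"

definition coin_tosses :: "nat \<Rightarrow> bool list pmf" where
  "coin_tosses l = pmf_of_set {w. length w = l}"

end

theory Submission
  imports Defs
begin

text \<open>The rounding ignores the fractional solution and the coins: it is a greedy algorithm with
  exponential prices. A row of load \<open>u\<close> has price \<open>\<beta> ^ u\<close>, the price of a column is the sum over its
  rows, and the column with the largest ratio of value to price is treated next; it is rejected iff
  one of its rows has load \<open>B = \<lfloor>b\<rfloor>\<close> already. Let each accepted column \<open>l\<close> raise dual variables of
  its rows by the increase of the row prices, scaled by the ratio of \<open>l\<close>. The total dual value is
  then at most \<open>\<beta> - 1\<close> times the accepted value. Along every rejected column \<open>j\<close> of degree \<open>d\<close> the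
  dual variables add up to at least \<open>c j * ln (\<beta> ^ B / d)\<close>, since all earlier ratios dominate that of
  \<open>j\<close>. For \<open>d = O(log m)\<close> and \<open>\<beta>\<close> of order \<open>(log m) powr (1 / B)\<close>, weak duality gives the factor
  \<open>O(\<beta>)\<close>, and \<open>1 / B \<le> 2 / b\<close> turns this into \<open>((log m)\<^sup>2) powr (1 / b)\<close>.

  The randomness of the matrix is needed only for the columns of higher degree, whose number is not
  bounded because \<open>n\<close> may be arbitrarily large compared to \<open>m\<close>: with high probability, their total
  value is below \<open>1\<close> or below that of the empty columns, which are always accepted.\<close>

section \<open>A primal-dual greedy algorithm\<close>

text \<open>With \<open>n\<close> unbounded in terms of \<open>m\<close>, no union bound over the
  columns is available: a column exceeds the degree C * log m with probability at most m^(2 - C),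
  but many columns may do so. They are never analysed one by one; only their total value counts, and
  it has to be paid by value that the greedy algorithm is known to collect. If the total is below 1,
  a column of value 1 is not among them, and weak duality for its unit vector shows that the
  accepted value is at least of order 1 / \<beta>. In the other case the empty columns pay directly.
  For failure probability m^(- \<gamma>) the choice C = 10 + 2 * \<gamma> works; it reaches the
  program only as an exponent \<open>r\<close> with C \<le> 2 ^ r. As the machine cannot multiply
  memory cells, the ideal base is rounded up to a power of two, and all its powers arise by
  doubling. The dual variables grow by the ratio of value to price because c * dS / S integrates to
  c * ln S: a price that climbs from the degree d to \<beta> ^ B has collected at least c * ln
  (\<beta> ^ B / d).\<close>

definition price :: "real \<Rightarrow> (nat \<Rightarrow> nat set) \<Rightarrow> (nat \<Rightarrow> nat) \<Rightarrow> nat \<Rightarrow> real" where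
  "price \<beta> E u j = (\<Sum>i\<in>E j. \<beta> ^ u i)"

text \<open>\<open>R\<close> collects the treated columns and \<open>F\<close> the accepted ones.
  Maximality of the ratio is demanded only when all values are positive: the program has to run on
  arbitrary input, where comparison by cross multiplication need not be transitive. For a rejection,
  the dual argument relies only on the full row.\<close>

inductive greedy ::
    "real \<Rightarrow> nat \<Rightarrow> (nat \<Rightarrow> nat set) \<Rightarrow> (nat \<Rightarrow> real) \<Rightarrow> nat \<Rightarrow>
     (nat \<Rightarrow> nat) \<Rightarrow> nat set \<Rightarrow> nat set \<Rightarrow> bool"
  for \<beta> B E c n where
  start: "greedy \<beta> B E c n (\<lambda>_. 0) {} {}"
| accept: "greedy \<beta> B E c n u R F \<Longrightarrow> l < n \<Longrightarrow> l \<notin> R \<Longrightarrow>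
    (\<And>j. (\<forall>j<n. c j > 0) \<Longrightarrow> j < n \<Longrightarrow> j \<notin> R \<Longrightarrow>
      c j * price \<beta> E u l \<le> c l * price \<beta> E u j) \<Longrightarrow>
    (\<And>i. i \<in> E l \<Longrightarrow> u i < B) \<Longrightarrow>
    greedy \<beta> B E c n (\<lambda>i. if i \<in> E l then u i + 1 else u i) (insert l R) (insert l F)"
| reject: "greedy \<beta> B E c n u R F \<Longrightarrow> l < n \<Longrightarrow> i \<in> E l \<Longrightarrow> B \<le> u i \<Longrightarrow>
    greedy \<beta> B E c n u (insert l R) F"

lemma greedy_subset: "greedy \<beta> B E c n u R F \<Longrightarrow> F \<subseteq> R \<and> R \<subseteq> {..<n}"
  by (induction rule: greedy.induct) auto

text \<open>What makes the rounded vector feasible: \<open>u i\<close> is the left side of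
  constraint \<open>i\<close> at the indicator vector of \<open>F\<close>.\<close>

lemma greedy_load:
  "greedy \<beta> B E c n u R F \<Longrightarrow> u i = card {j\<in>F. i \<in> E j} \<and> u i \<le> B"
proof (induction rule: greedy.induct)
  case start
  then show ?case by simp
next
  case (accept u R F l)
  have fin: "finite {j\<in>F. i \<in> E j}" and l: "l \<notin> F"
    using greedy_subset[OF accept.hyps(1)] accept.hyps(3) by (auto intro: finite_subset)
  have "{j \<in> insert l F. i \<in> E j} =
      (if i \<in> E l then insert l {j\<in>F. i \<in> E j} else {j\<in>F. i \<in> E j})" by auto
  with accept.IH accept.hyps(5)[of i] fin l show ?case by auto
qed auto

text \<open>Rejection requires a full row, which an empty column does not have. This is how the
  empty columns later pay for those of high degree.\<close>

lemma greedy_empty_column: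
  "greedy \<beta> B E c n u R F \<Longrightarrow> j \<in> R \<Longrightarrow> E j = {} \<Longrightarrow> j \<in> F"
  by (induction rule: greedy.induct) auto

lemma price_nonneg: "\<beta> \<ge> 0 \<Longrightarrow> price \<beta> E u j \<ge> 0"
  by (simp add: price_def sum_nonneg)

lemma price_pos: "\<beta> > 0 \<Longrightarrow> finite (E j) \<Longrightarrow> E j \<noteq> {} \<Longrightarrow> price \<beta> E u j > 0"
  by (simp add: price_def sum_pos)

text \<open>Accepting a column \<open>l\<close> raises the dual variable of each of its rows by the increase of
  \<open>\<beta> ^ u i\<close> times the ratio of \<open>c l\<close> to the price of \<open>l\<close>. As this ratio is maximal, the increments
  along any other column \<open>j\<close> add up to at least \<open>c j\<close> times the logarithmic growth of its price.\<close>

lemma greedy_dual: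
  fixes E :: "nat \<Rightarrow> nat set"
  assumes "greedy \<beta> B E c n u R F" and \<beta>: "\<beta> \<ge> 1" and c: "\<And>j. j < n \<Longrightarrow> c j > 0"
    and E: "\<And>j. E j \<subseteq> {..<m}"
  shows "\<exists>Y. (\<forall>i. Y i \<ge> 0) \<and> (\<Sum>i<m. Y i) \<le> (\<beta> - 1) * (\<Sum>j\<in>F. c j) \<and>
    (\<forall>j<n. j \<notin> R \<longrightarrow> c j * (ln (price \<beta> E u j) - ln (card (E j))) \<le> (\<Sum>i\<in>E j. Y i)) \<and>
    (\<forall>j\<in>R - F. c j * (B * ln \<beta> - ln (card (E j))) \<le> (\<Sum>i\<in>E j. Y i))"
  using assms(1)
proof (induction rule: greedy.induct)
  case start
  \<comment> \<open>With zero loads the price is the degree, so the logarithms cancel; for an empty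
    column both are \<open>ln 0\<close>.\<close>
  show ?case by (rule exI[of _ "\<lambda>_. 0"]) (simp add: price_def)
next
  case (accept u R F l)
  then obtain Y where Y0: "\<And>i. Y i \<ge> 0" and Ysum: "(\<Sum>i<m. Y i) \<le> (\<beta> - 1) * (\<Sum>j\<in>F. c j)"
    and Yun: "\<And>j. j < n \<Longrightarrow> j \<notin> R \<Longrightarrow>
      c j * (ln (price \<beta> E u j) - ln (card (E j))) \<le> (\<Sum>i\<in>E j. Y i)"
    and Yrej: "\<And>j. j \<in> R - F \<Longrightarrow> c j * (B * ln \<beta> - ln (card (E j))) \<le> (\<Sum>i\<in>E j. Y i)"
    by blast
  \<comment> \<open>If \<open>l\<close> is empty, this is 0 by the convention for division, and no
    price rises; the dual value then grows by less than (\<beta> - 1) * c l allows.\<close>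
  define \<rho> where "\<rho> = c l / price \<beta> E u l"
  define u' where "u' i = (if i \<in> E l then u i + 1 else u i)" for i
  define \<Delta> where "\<Delta> i = \<beta> ^ u' i - \<beta> ^ u i" for i
  define Y' where "Y' i = Y i + \<rho> * \<Delta> i" for i
  have finE: "finite (E j)" for j using E[of j] finite_subset by blast
  have \<rho>: "\<rho> \<ge> 0" using c[OF accept.hyps(2)] price_nonneg[of \<beta> E u l] \<beta> by (simp add: \<rho>_def)
  have \<Delta>_eq: "\<Delta> i = (if i \<in> E l then (\<beta> - 1) * \<beta> ^ u i else 0)" for i
    by (simp add: \<Delta>_def u'_def algebra_simps)
  have \<Delta>0: "\<Delta> i \<ge> 0" for i using \<beta> by (simp add: \<Delta>_eq)
  have price': "price \<beta> E u' j = price \<beta> E u j + (\<Sum>i\<in>E j. \<Delta> i)" for j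
    by (simp add: price_def \<Delta>_def sum_subtractf)
  have sumY': "(\<Sum>i\<in>E j. Y' i) = (\<Sum>i\<in>E j. Y i) + \<rho> * (\<Sum>i\<in>E j. \<Delta> i)" for j
    by (simp add: Y'_def sum.distrib sum_distrib_left)
  have grow: "(\<Sum>i\<in>E j. Y i) \<le> (\<Sum>i\<in>E j. Y' i)" for j
    using \<rho> \<Delta>0 by (simp add: sumY' sum_nonneg)
  have l: "l \<notin> F" "finite F" using greedy_subset[OF accept.hyps(1)] accept.hyps(3)
    by (auto intro: finite_subset)
  have "(\<Sum>i<m. \<Delta> i) = (\<Sum>i\<in>E l. \<Delta> i)"
    using E[of l] by (intro sum.mono_neutral_right) (auto simp: \<Delta>_eq)
  also have "\<dots> = (\<beta> - 1) * price \<beta> E u l"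
    by (simp add: \<Delta>_eq price_def sum_distrib_left)
  finally have "(\<Sum>i<m. Y' i) = (\<Sum>i<m. Y i) + \<rho> * ((\<beta> - 1) * price \<beta> E u l)"
    by (simp add: Y'_def sum.distrib flip: sum_distrib_left)
  also have "\<rho> * ((\<beta> - 1) * price \<beta> E u l) \<le> (\<beta> - 1) * c l"
    using \<beta> c[OF accept.hyps(2)] by (simp add: \<rho>_def)
  finally have 1: "(\<Sum>i<m. Y' i) \<le> (\<beta> - 1) * (\<Sum>j\<in>insert l F. c j)"
    using Ysum l by (simp add: algebra_simps)
  have 2: "c j * (ln (price \<beta> E u' j) - ln (card (E j))) \<le> (\<Sum>i\<in>E j. Y' i)"
    if j: "j < n" "j \<notin> insert l R" for j
  \<comment> \<open>A column without common rows keeps its price. Every empty column falls under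
    this case, so in the other one the price may be a divisor.\<close>
  proof (cases "E j \<inter> E l = {}")
    case True
    then have "(\<Sum>i\<in>E j. \<Delta> i) = 0" by (intro sum.neutral) (auto simp: \<Delta>_eq)
    with Yun[of j] j grow[of j] price'[of j] show ?thesis by simp
  next
    case False
    let ?S = "price \<beta> E u j" and ?D = "\<Sum>i\<in>E j. \<Delta> i"
    have S: "?S > 0" "price \<beta> E u l > 0"
      using False \<beta> by (auto intro!: price_pos finE)
    have D: "?D \<ge> 0" by (simp add: \<Delta>0 sum_nonneg)
    have "c j * price \<beta> E u l \<le> c l * ?S" using accept.hyps(4)[of j] c j by auto
    then have "c j / ?S \<le> \<rho>" using S by (simp add: \<rho>_def field_simps)
    then have "c j / ?S * ?D \<le> \<rho> * ?D" using D by (rule mult_right_mono)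
    \<comment> \<open>By ln (1 + z) \<le> z, the logarithm of the price grows at most by the
      relative growth of the price, which the maximal ratio \<open>\<rho>\<close> pays for.\<close>
    moreover have "ln (?S + ?D) - ln ?S \<le> ?D / ?S"
    proof -
      have "?S + ?D = ?S * (1 + ?D / ?S)" using S by (simp add: field_simps)
      moreover have "1 + ?D / ?S > 0" using S D by (intro add_pos_nonneg) auto
      ultimately have "ln (?S + ?D) - ln ?S = ln (1 + ?D / ?S)"
        using S by (simp add: ln_mult)
      also have "\<dots> \<le> ?D / ?S" using S D by (intro ln_add_one_self_le_self) auto
      finally show ?thesis .
    qed
    then have "c j * (ln (?S + ?D) - ln ?S) \<le> c j / ?S * ?D"
      using c[of j] j by (simp add: mult_left_mono flip: times_divide_eq_right)
    ultimately show ?thesis using Yun[of j] j unfolding sumY' price' by (simp add: algebra_simps)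
  qed
  have 3: "c j * (B * ln \<beta> - ln (card (E j))) \<le> (\<Sum>i\<in>E j. Y' i)"
    if "j \<in> insert l R - insert l F" for j
    using Yrej[of j] grow[of j] that by auto
  have "\<forall>i. Y' i \<ge> 0" using Y0 \<rho> \<Delta>0 by (simp add: Y'_def)
  with 1 2 3 show ?case unfolding u'_def by blast
next
  case (reject u R F l i)
  then obtain Y where Y: "\<And>i. Y i \<ge> 0" "(\<Sum>i<m. Y i) \<le> (\<beta> - 1) * (\<Sum>j\<in>F. c j)"
    "\<And>j. j < n \<Longrightarrow> j \<notin> R \<Longrightarrow>
      c j * (ln (price \<beta> E u j) - ln (card (E j))) \<le> (\<Sum>i\<in>E j. Y i)"
    "\<And>j. j \<in> R - F \<Longrightarrow> c j * (B * ln \<beta> - ln (card (E j))) \<le> (\<Sum>i\<in>E j. Y i)"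
    by blast
  have "finite (E l)" using E[of l] finite_subset by blast
  have "\<beta> ^ B \<le> \<beta> ^ u i" using reject.hyps \<beta> by (intro power_increasing) auto
  also have "\<dots> \<le> price \<beta> E u l"
    unfolding price_def using reject.hyps \<beta> \<open>finite (E l)\<close>
    by (intro member_le_sum) auto
  finally have "ln (\<beta> ^ B) \<le> ln (price \<beta> E u l)" using \<beta> by (subst ln_le_cancel_iff) (auto intro: less_le_trans[of 0 "\<beta> ^ B"])
  then have "B * ln \<beta> \<le> ln (price \<beta> E u l)" using \<beta> by (simp add: ln_realpow)
  then have "c l * (B * ln \<beta> - ln (card (E l))) \<le> c l * (ln (price \<beta> E u l) - ln (card (E l)))"
    using c[OF reject.hyps(2)] by (intro mult_left_mono) auto
  \<comment> \<open>The rule may also fire for a treated column; then nothing changes and the old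
    bounds remain.\<close>
  then have "c l * (B * ln \<beta> - ln (card (E l))) \<le> (\<Sum>i\<in>E l. Y i)" if "l \<notin> R"
    using Y(3)[OF reject.hyps(2) that] by simp
  with Y show ?case by (intro exI[of _ Y]) auto
qed

text \<open>Weak duality. The degree bound says d \<le> (\<beta> / 2) ^ B, so B * ln \<beta> - ln d
  \<ge> B * ln 2 \<ge> B / 2: up to the factor B / 2, \<open>Y\<close> covers each rejected column
  outside \<open>H\<close>. Exchanging the order of summation against \<open>x\<close> and using the
  row bounds limits their value by \<open>b\<close> times the total of \<open>Y\<close>. Vector and
  bound are general, so that a unit vector with bound 1 can be inserted as well.\<close>

lemma greedy_bound:
  fixes E :: "nat \<Rightarrow> nat set" and b \<beta> :: real
  assumes g: "greedy \<beta> B E c n u {..<n} F" and \<beta>: "\<beta> \<ge> 1" and c: "\<And>j. j < n \<Longrightarrow> c j > 0"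
    and E: "\<And>j. E j \<subseteq> {..<m}"
    and light: "\<And>j. j < n \<Longrightarrow> j \<notin> H \<Longrightarrow> card (E j) * 2 ^ B \<le> \<beta> ^ B"
    and x: "\<And>j. j < n \<Longrightarrow> 0 \<le> x j \<and> x j \<le> 1"
    and Ax: "\<And>i. i < m \<Longrightarrow> (\<Sum>j | j < n \<and> i \<in> E j. x j) \<le> b"
    and b: "0 \<le> b"  and B: "1 \<le> B" and H: "H \<subseteq> {..<n}"
  shows "(\<Sum>j<n. c j * x j) \<le> (1 + 2 * b * \<beta> / B) * (\<Sum>j\<in>F. c j) + (\<Sum>j\<in>H. c j * x j)"
proof -
  obtain Y where Y0: "\<And>i. Y i \<ge> 0" and Ysum: "(\<Sum>i<m. Y i) \<le> (\<beta> - 1) * (\<Sum>j\<in>F. c j)"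
    and Yrej: "\<And>j. j \<in> {..<n} - F \<Longrightarrow> c j * (B * ln \<beta> - ln (card (E j))) \<le> (\<Sum>i\<in>E j. Y i)"
    using greedy_dual[OF g \<beta> c E] by auto
  have F: "F \<subseteq> {..<n}" using greedy_subset[OF g] by auto
  have finE: "finite (E j)" for j using E[of j] finite_subset by blast
  have fin: "finite F" "finite H" using F H finite_subset by blast+
  let ?N = "{..<n} - F - H"
  have ALG: "(\<Sum>j\<in>F. c j) \<ge> 0" using F c by (intro sum_nonneg) (auto intro: less_imp_le)
  have rej: "c j * (B / 2) \<le> (\<Sum>i\<in>E j. Y i)" if j: "j \<in> ?N" for j
  proof -
    have "E j \<noteq> {}" using greedy_empty_column[OF g, of j] j by auto
    then have d: "card (E j) > 0" using finE by (simp add: card_gt_0_iff)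
    have "ln (card (E j) * 2 ^ B) \<le> ln (\<beta> ^ B)"
      using light[of j] j d \<beta> by (subst ln_le_cancel_iff) auto
    then have "B * ln 2 \<le> B * ln \<beta> - ln (card (E j))"
      using d \<beta> by (simp add: ln_mult ln_realpow)
    moreover have "real B * (1 / 2) \<le> B * ln 2"
      using ln2_ge_two_thirds by (intro mult_left_mono) auto
    ultimately have "c j * (B / 2) \<le> c j * (B * ln \<beta> - ln (card (E j)))"
      using c[of j] j by (intro mult_left_mono) auto
    also have "\<dots> \<le> (\<Sum>i\<in>E j. Y i)" using Yrej j by blast
    finally show ?thesis .
  qed
  have "(\<Sum>j\<in>?N. c j * x j) * (B / 2) = (\<Sum>j\<in>?N. c j * (B / 2) * x j)"
    unfolding sum_distrib_right by (intro sum.cong) auto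
  also have "\<dots> \<le> (\<Sum>j\<in>?N. (\<Sum>i\<in>E j. Y i) * x j)"
    using rej x by (intro sum_mono mult_right_mono) auto
  also have "\<dots> \<le> (\<Sum>j<n. (\<Sum>i\<in>E j. Y i) * x j)"
    using x Y0 by (intro sum_mono2) (auto intro!: mult_nonneg_nonneg sum_nonneg)
  also have "\<dots> = (\<Sum>j<n. (\<Sum>i<m. if i \<in> E j then Y i * x j else 0))"
  proof (intro sum.cong refl)
    fix j
    have "(\<Sum>i<m. if i \<in> E j then Y i * x j else 0) = (\<Sum>i\<in>{..<m} \<inter> E j. Y i * x j)"
      by (simp add: sum.If_cases Int_def)
    also have "{..<m} \<inter> E j = E j" using E by blast
    finally show "(\<Sum>i\<in>E j. Y i) * x j = (\<Sum>i<m. if i \<in> E j then Y i * x j else 0)"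
      by (simp add: sum_distrib_right)
  qed
  also have "\<dots> = (\<Sum>i<m. \<Sum>j<n. if i \<in> E j then Y i * x j else 0)" by (rule sum.swap)
  also have "\<dots> = (\<Sum>i<m. Y i * (\<Sum>j | j < n \<and> i \<in> E j. x j))"
    by (simp add: sum_distrib_left sum.If_cases Int_def)
  also have "\<dots> \<le> (\<Sum>i<m. Y i * b)" using Y0 Ax by (intro sum_mono mult_left_mono) auto
  also have "\<dots> = (\<Sum>i<m. Y i) * b" by (simp add: sum_distrib_right)
  also have "\<dots> \<le> (\<beta> - 1) * (\<Sum>j\<in>F. c j) * b" using Ysum b by (rule mult_right_mono)
  also have "\<dots> \<le> \<beta> * (\<Sum>j\<in>F. c j) * b" using ALG b by (intro mult_right_mono) auto
  finally have N: "(\<Sum>j\<in>?N. c j * x j) \<le> 2 * b * \<beta> / B * (\<Sum>j\<in>F. c j)"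
    using B by (simp add: field_simps)
  have "(\<Sum>j<n. c j * x j) \<le> (\<Sum>j\<in>F \<union> ?N \<union> H. c j * x j)"
    using c x fin F H by (intro sum_mono2) (auto intro!: mult_nonneg_nonneg intro: less_imp_le)
  also have "\<dots> \<le> (\<Sum>j\<in>F. c j * x j) + (\<Sum>j\<in>?N. c j * x j) + (\<Sum>j\<in>H. c j * x j)"
  proof -
    have nn: "c j * x j \<ge> 0" if "j < n" for j using c[OF that] x[OF that] by simp
    have "(\<Sum>j\<in>F \<union> ?N \<union> H. c j * x j) \<le> (\<Sum>j\<in>F \<union> ?N. c j * x j) + (\<Sum>j\<in>H. c j * x j)"
      using fin F H nn by (subst sum_Un) (auto intro!: sum_nonneg)
    also have "(\<Sum>j\<in>F \<union> ?N. c j * x j) \<le> (\<Sum>j\<in>F. c j * x j) + (\<Sum>j\<in>?N. c j * x j)"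
      using fin F H nn by (subst sum_Un) (auto intro!: sum_nonneg)
    finally show ?thesis by simp
  qed
  also have "(\<Sum>j\<in>F. c j * x j) \<le> (\<Sum>j\<in>F. c j)"
    using F c x by (intro sum_mono) (auto intro!: mult_left_le intro: less_imp_le)
  finally show ?thesis using N by (simp add: algebra_simps)
qed

section \<open>Total correctness with time bounds\<close>

text \<open>Execution is deterministic, so a halting run is the only run, and its existence
  expresses total correctness within \<open>N\<close> steps.\<close>

definition runs :: "com \<Rightarrow> state \<Rightarrow> nat \<Rightarrow> (state \<Rightarrow> bool) \<Rightarrow> bool" where
  "runs P s N Q \<longleftrightarrow> (\<exists>t s'. exec P s t s' \<and> t \<le> N \<and> Q s')"

fun writes :: "com \<Rightarrow> cell_name set" where
  "writes Skip = {}"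
| "writes (NSet v e f) = {v}"
| "writes (RSet v e f g) = {v}"
| "writes (Flip v e) = {v}"
| "writes (Seq P Q) = writes P \<union> writes Q"
| "writes (Cond e P Q) = writes P \<union> writes Q"
| "writes (While e P) = writes P"

definition agree :: "cell_name set \<Rightarrow> state \<Rightarrow> state \<Rightarrow> bool" where
  "agree V s s' \<longleftrightarrow> (\<forall>v. v \<notin> V \<longrightarrow> nmem s' v = nmem s v \<and> rmem s' v = rmem s v)"

lemma agree_trans: "agree V s s' \<Longrightarrow> agree W s' s'' \<Longrightarrow> V \<subseteq> U \<Longrightarrow> W \<subseteq> U \<Longrightarrow> agree U s s''"
  unfolding agree_def by (metis subsetD)

lemma agree_nmem: "agree V s s' \<Longrightarrow> v \<notin> V \<Longrightarrow> nmem s' v = nmem s v"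
  and agree_rmem: "agree V s s' \<Longrightarrow> v \<notin> V \<Longrightarrow> rmem s' v = rmem s v"
  by (auto simp: agree_def)

lemma nmem_set_ncell: "nmem (set_ncell v i a s) = (nmem s)(v := (nmem s v)(i := a))"
  and rmem_set_ncell [simp]: "rmem (set_ncell v i a s) = rmem s"
  and nmem_set_rcell [simp]: "nmem (set_rcell v i j r s) = nmem s"
  and rmem_set_rcell:
    "rmem (set_rcell v i j r s) = (rmem s)(v := (rmem s v)(i := (rmem s v i)(j := r)))"
  by (simp_all add: set_ncell_def set_rcell_def)

lemma nmem_set_ncell_apply [simp]:
  "nmem (set_ncell v i a s) w k = (if w = v \<and> k = i then a else nmem s w k)"
  and rmem_set_rcell_apply [simp]:
  "rmem (set_rcell v i j r s) w k l = (if w = v \<and> k = i \<and> l = j then r else rmem s w k l)"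
  by (simp_all add: nmem_set_ncell rmem_set_rcell)

lemma exec_agree: "exec P s t s' \<Longrightarrow> agree (writes P) s s'"
  by (induction rule: exec.induct) (auto simp: agree_def nmem_set_ncell rmem_set_rcell)

text \<open>A consequence rule that also hands over the frame; thus the specifications of the phases
  list only the cells that they compute.\<close>

lemma runs_weaken:
  assumes "runs P s N Q" "N \<le> N'" "\<And>s'. Q s' \<Longrightarrow> agree (writes P) s s' \<Longrightarrow> Q' s'"
  shows "runs P s N' Q'"
  using assms exec_agree unfolding runs_def by (meson order_trans)

lemma runs_NSet: "Q (set_ncell v (nval e s) (nval f s) s) \<Longrightarrow> 1 \<le> N \<Longrightarrow> runs (NSet v e f) s N Q"
  unfolding runs_def using exec.NSet by blast

lemma runs_RSet: "Q (set_rcell v (nval e s) (nval f s) (rval g s) s) \<Longrightarrow> 1 \<le> N \<Longrightarrow> runs (RSet v e f g) s N Q"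
  unfolding runs_def using exec.RSet by blast

lemma runs_Skip: "Q s \<Longrightarrow> 1 \<le> N \<Longrightarrow> runs Skip s N Q"
  unfolding runs_def using exec.Skip by blast

text \<open>The claim about the second program sits inside the postcondition of the first, so that
  sequences are processed from the front with the frame at hand. The extra unit is the charge for
  \<open>Seq\<close>.\<close>

lemma runs_Seq:
  assumes "runs P s M (\<lambda>s'. agree (writes P) s s' \<longrightarrow> runs P' s' N Q)" "M + N + 1 \<le> K"
  shows "runs (Seq P P') s K Q"
proof -
  obtain t s' where 1: "exec P s t s'" "t \<le> M" "runs P' s' N Q"
    using assms(1) exec_agree unfolding runs_def by blast
  then obtain u s'' where 2: "exec P' s' u s''" "u \<le> N" "Q s''" unfolding runs_def by blast
  have "t + u + 1 \<le> K" using 1 2 assms(2) by simp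
  with exec.Seq[OF 1(1) 2(1)] 2(3) show ?thesis unfolding runs_def by blast
qed

lemma runs_Cond:
  assumes "bval e s \<Longrightarrow> runs P s N Q" "\<not> bval e s \<Longrightarrow> runs P' s N Q" "N + 1 \<le> K"
  shows "runs (Cond e P P') s K Q"
proof (cases "bval e s")
  case True
  then obtain t s' where 1: "exec P s t s'" "t \<le> N" "Q s'" using assms unfolding runs_def by blast
  have "t + 1 \<le> K" using 1 assms(3) by simp
  with exec.CondTrue[OF True 1(1)] 1(3) show ?thesis unfolding runs_def by blast
next
  case False
  then obtain t s' where 1: "exec P' s t s'" "t \<le> N" "Q s'" using assms unfolding runs_def by blast
  have "t + 1 \<le> K" using 1 assms(3) by simp
  with exec.CondFalse[OF False 1(1)] 1(3) show ?thesis unfolding runs_def by blast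
qed

definition For :: "cell_name \<Rightarrow> nexp \<Rightarrow> com \<Rightarrow> com" where
  "For v e P = Seq (NSet v (NConst 0) (NConst 0))
     (While (NLess (NCell v (NConst 0)) e)
       (Seq P (NSet v (NConst 0) (NAdd (NCell v (NConst 0)) (NConst 1)))))"

lemma writes_For [simp]: "writes (For v e P) = insert v (writes P)"
  by (auto simp: For_def)

text \<open>\<open>I k\<close> refers to the state in which the counter already has the value
  \<open>k\<close>. A round costs the body, the increment, and one unit each for \<open>Seq\<close>
  and \<open>While\<close>, hence \<open>K + 3\<close>; the failing test, the initialization and the
  outer \<open>Seq\<close> make up the other \<open>3\<close>.\<close>

lemma runs_For:
  assumes init: "I 0 (set_ncell v 0 0 s)"
    and step: "\<And>k s'. k < N \<Longrightarrow> I k s' \<Longrightarrow> nmem s' v 0 = k \<Longrightarrow> agree (insert v (writes P)) s s' \<Longrightarrow>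
      runs P s' K (\<lambda>s''. I (Suc k) (set_ncell v 0 (Suc k) s''))"
    and v: "v \<notin> writes P"
    and e: "\<And>s'. agree (insert v (writes P)) s s' \<Longrightarrow> nval e s' = N"
    and K': "N * (K + 3) + 3 \<le> K'"
  shows "runs (For v e P) s K' (I N)"
proof -
  let ?W = "While (NLess (NCell v (NConst 0)) e)
       (Seq P (NSet v (NConst 0) (NAdd (NCell v (NConst 0)) (NConst 1))))"
  have W: "runs ?W s' ((N - k) * (K + 3) + 1) (I N)"
    if "k \<le> N" "I k s'" "nmem s' v 0 = k" "agree (insert v (writes P)) s s'" for k s'
    using that
  proof (induction "N - k" arbitrary: k s')
    case 0
    then have "\<not> bval (NLess (NCell v (NConst 0)) e) s'" using e by simp
    from exec.WhileFalse[OF this] 0 show ?case unfolding runs_def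
      by (intro exI[of _ 1] exI[of _ s']) auto
  next
    case (Suc d)
    then have k: "k < N" by simp
    obtain t s'' where 1: "exec P s' t s''" "t \<le> K" "I (Suc k) (set_ncell v 0 (Suc k) s'')"
      using step[OF k Suc.prems(2-4)] unfolding runs_def by blast
    have ag: "agree (writes P) s' s''" using exec_agree[OF 1(1)] .
    have vk: "nmem s'' v 0 = k" using agree_nmem[OF ag v] Suc.prems by simp
    let ?s = "set_ncell v 0 (Suc k) s''"
    have "agree (insert v (writes P)) s' ?s"
      using ag by (auto simp: agree_def nmem_set_ncell)
    then have ags: "agree (insert v (writes P)) s ?s"
      using agree_trans[OF Suc.prems(4)] by blast
    have "exec (NSet v (NConst 0) (NAdd (NCell v (NConst 0)) (NConst 1))) s'' 1 ?s"
      using exec.NSet[of v "NConst 0" "NAdd (NCell v (NConst 0)) (NConst 1)" s''] vk by simp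
    from exec.Seq[OF 1(1) this] have body:
      "exec (Seq P (NSet v (NConst 0) (NAdd (NCell v (NConst 0)) (NConst 1)))) s' (t + 1 + 1) ?s" .
    have "runs ?W ?s ((N - Suc k) * (K + 3) + 1) (I N)"
      using Suc.hyps(1)[of "Suc k" ?s] Suc.hyps(2) k 1(3) ags by simp
    then obtain u r where 2: "exec ?W ?s u r" "u \<le> (N - Suc k) * (K + 3) + 1" "I N r"
      unfolding runs_def by blast
    have "bval (NLess (NCell v (NConst 0)) e) s'" using e[OF Suc.prems(4)] Suc.prems k by simp
    from exec.WhileTrue[OF this body 2(1)]
    have "exec ?W s' (t + 1 + 1 + u + 1) r" .
    moreover have "t + 1 + 1 + u + 1 \<le> (N - k) * (K + 3) + 1"
    proof -
      have "N - k = Suc (N - Suc k)" using k by simp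
      then show ?thesis using 1(2) 2(2) by simp
    qed
    ultimately show ?case using 2(3) unfolding runs_def by blast
  qed
  have "agree (insert v (writes P)) s (set_ncell v 0 0 s)"
    by (auto simp: agree_def nmem_set_ncell)
  with W[of 0 "set_ncell v 0 0 s"] init have "runs ?W (set_ncell v 0 0 s) (N * (K + 3) + 1) (I N)"
    by simp
  then show ?thesis unfolding For_def using K'
    by (intro runs_Seq[where M = 1] runs_NSet) auto
qed

section \<open>The greedy algorithm as a program\<close>

text \<open>Cells: \<open>B\<close> is the capacity (capped at \<open>m + n\<close> for the sake of the running time), \<open>L\<close> the
  rounded logarithm of \<open>m\<close>, and \<open>g\<close> the binary logarithm of \<open>\<beta>\<close>; \<open>u i\<close> is the load of row \<open>i\<close>, \<open>f j\<close>
  tells whether column \<open>j\<close> has been treated, \<open>l\<close> is the column chosen next (\<open>n\<close> if there is none yet),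
  and \<open>k\<close> tells whether it fits. As two memory cells cannot be multiplied, the products
  \<open>\<beta> ^ u * c j\<close> are tabulated in \<open>q\<close>, and ratios are compared by cross multiplication: \<open>p\<close> is \<open>c l\<close>
  times the price of \<open>j\<close>, and \<open>r\<close> is \<open>c j\<close> times the price of \<open>l\<close>.\<close>

abbreviation reg :: "cell_name \<Rightarrow> nexp" where "reg v \<equiv> NCell v (NConst 0)"
abbreviation rreg :: "cell_name \<Rightarrow> rexp" where "rreg v \<equiv> RCell v (NConst 0) (NConst 0)"
abbreviation entry_pos :: "nexp \<Rightarrow> nexp \<Rightarrow> bexp" where
  "entry_pos i j \<equiv> RLess (RConst 0) (RCell ''A'' i j)"

text \<open>Reals cannot be rounded, so the floor of \<open>b\<close> is found by counting. The cap
  is harmless: no load exceeds \<open>n\<close>, and a capacity of at least \<open>m\<close> already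
  keeps \<open>\<sigma>\<close> at most 1.\<close>

definition capacity_com :: com where
  "capacity_com = Seq (NSet ''B'' (NConst 0) (NConst 0))
     (For ''i'' (NAdd (reg ''m'') (reg ''n''))
       (Cond (RLess (rreg ''b'') (RNat (NAdd (reg ''B'') (NConst 1)))) Skip
         (NSet ''B'' (NConst 0) (NAdd (reg ''B'') (NConst 1)))))"

definition log_com :: com where
  "log_com = Seq (NSet ''L'' (NConst 0) (NConst 0)) (Seq (NSet ''v'' (NConst 0) (NConst 1))
     (For ''i'' (reg ''m'')
       (Cond (NLess (reg ''v'') (reg ''m''))
         (Seq (NSet ''v'' (NConst 0) (NAdd (reg ''v'') (reg ''v'')))
           (NSet ''L'' (NConst 0) (NAdd (reg ''L'') (NConst 1)))) Skip)))"

text \<open>Each round multiplies \<open>w\<close> by 2 ^ B until it reaches \<open>L\<close>; for B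
  > 0, 2 ^ \<sigma> is thus the B-th root of \<open>L\<close>, rounded up to a power of two. The
  offset \<open>r\<close> makes room for the constant in the degree limit.\<close>

definition base_com :: "nat \<Rightarrow> com" where
  "base_com r = Seq (NSet ''g'' (NConst 0) (NConst r)) (Seq (NSet ''w'' (NConst 0) (NConst 1))
     (For ''i'' (reg ''m'')
       (Cond (NLess (reg ''w'') (reg ''L''))
         (Seq (For ''t'' (reg ''B'') (NSet ''w'' (NConst 0) (NAdd (reg ''w'') (reg ''w''))))
           (NSet ''g'' (NConst 0) (NAdd (reg ''g'') (NConst 1)))) Skip)))"

definition table_com :: com where
  "table_com = Seq
     (For ''j'' (reg ''n'') (RSet ''q'' (NConst 0) (reg ''j'') (RCell ''c'' (NConst 0) (reg ''j''))))
     (For ''a'' (reg ''B'') (For ''j'' (reg ''n'')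
       (Seq (RSet ''q'' (NAdd (reg ''a'') (NConst 1)) (reg ''j'') (RCell ''q'' (reg ''a'') (reg ''j'')))
         (For ''t'' (reg ''g'')
           (RSet ''q'' (NAdd (reg ''a'') (NConst 1)) (reg ''j'')
             (RScale 2 (RCell ''q'' (NAdd (reg ''a'') (NConst 1)) (reg ''j''))))))))"

definition compare_com :: com where
  "compare_com = Seq (RSet ''p'' (NConst 0) (NConst 0) (RConst 0))
     (Seq (RSet ''r'' (NConst 0) (NConst 0) (RConst 0))
     (For ''i'' (reg ''m'')
       (Seq
         (Cond (entry_pos (reg ''i'') (reg ''j''))
           (RSet ''p'' (NConst 0) (NConst 0)
             (RAdd (rreg ''p'') (RCell ''q'' (NCell ''u'' (reg ''i'')) (reg ''l'')))) Skip)
         (Cond (entry_pos (reg ''i'') (reg ''l''))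
           (RSet ''r'' (NConst 0) (NConst 0)
             (RAdd (rreg ''r'') (RCell ''q'' (NCell ''u'' (reg ''i'')) (reg ''j'')))) Skip))))"

definition pick_com :: com where
  "pick_com = Seq (NSet ''l'' (NConst 0) (reg ''n''))
     (For ''j'' (reg ''n'') (Seq compare_com
       (Cond (BAnd (NLess (NCell ''f'' (reg ''j'')) (NConst 1))
           (BNot (BAnd (NLess (reg ''l'') (reg ''n'')) (BNot (RLess (rreg ''p'') (rreg ''r''))))))
         (NSet ''l'' (NConst 0) (reg ''j'')) Skip)))"

definition test_com :: com where
  "test_com = Seq (NSet ''k'' (NConst 0) (NConst 1))
     (For ''i'' (reg ''m'')
       (Cond (BAnd (entry_pos (reg ''i'') (reg ''l''))
           (BNot (NLess (NCell ''u'' (reg ''i'')) (reg ''B''))))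
         (NSet ''k'' (NConst 0) (NConst 0)) Skip))"

definition update_com :: com where
  "update_com = Seq (NSet ''f'' (reg ''l'') (NConst 1))
     (Cond (NLess (NConst 0) (reg ''k''))
       (Seq (RSet ''y'' (NConst 0) (reg ''l'') (RConst 1))
         (For ''i'' (reg ''m'')
           (Cond (entry_pos (reg ''i'') (reg ''l''))
             (NSet ''u'' (reg ''i'') (NAdd (NCell ''u'' (reg ''i'')) (NConst 1))) Skip)))
       Skip)"

definition greedy_com :: com where
  "greedy_com = For ''a'' (reg ''n'') (Seq pick_com (Seq test_com update_com))"

definition rounding_com :: "nat \<Rightarrow> com" where
  "rounding_com r =
     Seq capacity_com (Seq log_com (Seq (base_com r) (Seq table_com greedy_com)))"

lemma writes_com [simp]:
  "writes capacity_com = {''B'', ''i''}"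
  "writes log_com = {''L'', ''v'', ''i''}"
  "writes (base_com r) = {''g'', ''w'', ''i'', ''t''}"
  "writes table_com = {''q'', ''a'', ''j'', ''t''}"
  "writes compare_com = {''p'', ''r'', ''i''}"
  "writes pick_com = {''l'', ''j'', ''p'', ''r'', ''i''}"
  "writes test_com = {''k'', ''i''}"
  "writes update_com = {''f'', ''y'', ''u'', ''i''}"
  by (auto simp: capacity_com_def log_com_def base_com_def table_com_def compare_com_def
    pick_com_def test_com_def update_com_def)

definition holds_input ::
    "nat \<Rightarrow> nat \<Rightarrow> (nat \<Rightarrow> nat \<Rightarrow> real) \<Rightarrow> real \<Rightarrow> (nat \<Rightarrow> real) \<Rightarrow> state \<Rightarrow> bool" where
  "holds_input m n a b c s \<longleftrightarrow> nmem s ''m'' 0 = m \<and> nmem s ''n'' 0 = n \<and> rmem s ''A'' = a \<and>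
     rmem s ''b'' 0 0 = b \<and> rmem s ''c'' 0 = c"

lemma holds_input_agree:
  "agree V s s' \<Longrightarrow> holds_input m n a b c s \<Longrightarrow> {''m'', ''n'', ''A'', ''b'', ''c''} \<inter> V = {} \<Longrightarrow>
    holds_input m n a b c s'"
  unfolding holds_input_def agree_def by (metis disjoint_iff insertCI)

section \<open>Correctness of the preprocessing phases\<close>

lemma runs_capacity:
  assumes inp: "holds_input m n a b c s"
  shows "runs capacity_com s (5 * (m + n) + 6) (\<lambda>s'. nmem s' ''B'' 0 = min (m + n) (nat \<lfloor>b\<rfloor>))"
  unfolding capacity_com_def
proof (rule runs_Seq[where M = 1 and N = "5 * (m + n) + 4"], rule runs_NSet, rule impI)
  let ?s = "set_ncell ''B'' (nval (NConst 0) s) (nval (NConst 0) s) s"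
  assume ag: "agree (writes (NSet ''B'' (NConst 0) (NConst 0))) s ?s"
  have inp': "holds_input m n a b c ?s" using holds_input_agree[OF ag inp] by simp
  show "runs (For ''i'' (NAdd (reg ''m'') (reg ''n''))
       (Cond (RLess (rreg ''b'') (RNat (NAdd (reg ''B'') (NConst 1)))) Skip
         (NSet ''B'' (NConst 0) (NAdd (reg ''B'') (NConst 1))))) ?s (5 * (m + n) + 4)
       (\<lambda>s'. nmem s' ''B'' 0 = min (m + n) (nat \<lfloor>b\<rfloor>))"
  proof (rule runs_For[where I = "\<lambda>k s'. nmem s' ''B'' 0 = min k (nat \<lfloor>b\<rfloor>)" and N = "m + n" and K = 2])
    fix k s'
    assume k: "k < m + n" "nmem s' ''B'' 0 = min k (nat \<lfloor>b\<rfloor>)"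
      and ag: "agree (insert ''i'' (writes (Cond (RLess (rreg ''b'') (RNat (NAdd (reg ''B'') (NConst 1)))) Skip
         (NSet ''B'' (NConst 0) (NAdd (reg ''B'') (NConst 1)))))) ?s s'"
    have "rmem s' ''b'' 0 0 = b" using holds_input_agree[OF ag inp'] by (simp add: holds_input_def)
    moreover have "min (Suc k) (nat \<lfloor>b\<rfloor>) =
        (if b < real (min k (nat \<lfloor>b\<rfloor>)) + 1 then min k (nat \<lfloor>b\<rfloor>) else Suc (min k (nat \<lfloor>b\<rfloor>)))"
      by (auto simp: min_def) linarith+
    ultimately show "runs (Cond (RLess (rreg ''b'') (RNat (NAdd (reg ''B'') (NConst 1)))) Skip
         (NSet ''B'' (NConst 0) (NAdd (reg ''B'') (NConst 1)))) s' 2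
         (\<lambda>s''. nmem (set_ncell ''i'' 0 (Suc k) s'') ''B'' 0 = min (Suc k) (nat \<lfloor>b\<rfloor>))"
      using k by (intro runs_Cond[where N = 1] runs_Skip runs_NSet) (auto simp: add.commute)
  next
    fix s' assume "agree (insert ''i'' (writes (Cond (RLess (rreg ''b'') (RNat (NAdd (reg ''B'') (NConst 1)))) Skip
         (NSet ''B'' (NConst 0) (NAdd (reg ''B'') (NConst 1)))))) ?s s'"
    from holds_input_agree[OF this inp'] show "nval (NAdd (reg ''m'') (reg ''n'')) s' = m + n"
      by (simp add: holds_input_def)
  qed auto
qed auto

lemma runs_log:
  assumes inp: "holds_input m n a b c s"
  shows "runs log_com s (7 * m + 7) (\<lambda>s'. let L = nmem s' ''L'' 0 in
    m \<le> 2 ^ L \<and> L \<le> m \<and> (L > 0 \<longrightarrow> 2 ^ (L - 1) < m))"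
proof -
  let ?body = "Cond (NLess (reg ''v'') (reg ''m''))
         (Seq (NSet ''v'' (NConst 0) (NAdd (reg ''v'') (reg ''v'')))
           (NSet ''L'' (NConst 0) (NAdd (reg ''L'') (NConst 1)))) Skip"
  let ?I = "\<lambda>k s'. nmem s' ''v'' 0 = 2 ^ nmem s' ''L'' 0 \<and> nmem s' ''L'' 0 \<le> k \<and>
    (m \<le> nmem s' ''v'' 0 \<or> nmem s' ''L'' 0 = k) \<and>
    (nmem s' ''L'' 0 > 0 \<longrightarrow> 2 ^ (nmem s' ''L'' 0 - 1) < m)"
  have loop: "runs (For ''i'' (reg ''m'') ?body) s1 (7 * m + 3) (\<lambda>s'. let L = nmem s' ''L'' 0 in
    m \<le> 2 ^ L \<and> L \<le> m \<and> (L > 0 \<longrightarrow> 2 ^ (L - 1) < m))"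
    if inp1: "holds_input m n a b c s1" and s1: "nmem s1 ''L'' 0 = 0" "nmem s1 ''v'' 0 = 1" for s1
  proof (rule runs_weaken)
    show "runs (For ''i'' (reg ''m'') ?body) s1 (7 * m + 3) (?I m)"
    proof (rule runs_For[where I = ?I and K = 4])
      fix k s'
      assume k: "k < m" "?I k s'" and ag: "agree (insert ''i'' (writes ?body)) s1 s'"
      have "nmem s' ''m'' 0 = m" using holds_input_agree[OF ag inp1] by (simp add: holds_input_def)
      then show "runs ?body s' 4 (\<lambda>s''. ?I (Suc k) (set_ncell ''i'' 0 (Suc k) s''))"
        using k
        by (intro runs_Cond[where N = 3] runs_Skip runs_Seq[where M = 1 and N = 1] runs_NSet impI) auto
    next
      fix s' assume "agree (insert ''i'' (writes ?body)) s1 s'"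
      from holds_input_agree[OF this inp1] show "nval (reg ''m'') s' = m"
        by (simp add: holds_input_def)
    qed (use s1 in auto)
  next
    fix s' assume "?I m s'"
    moreover have "m < 2 ^ m" by (rule less_exp)
    ultimately show "let L = nmem s' ''L'' 0 in
      m \<le> 2 ^ L \<and> L \<le> m \<and> (L > 0 \<longrightarrow> 2 ^ (L - 1) < m)" by (auto simp: Let_def)
  qed simp
  show ?thesis unfolding log_com_def
    by (intro runs_Seq[where M = 1 and N = "7 * m + 5"] runs_Seq[where M = 1 and N = "7 * m + 3"]
        runs_NSet impI loop) (use inp in \<open>auto simp: holds_input_def\<close>)
qed

text \<open>The two bounds say that \<open>\<sigma>\<close> is the least admissible exponent. If B =
  0, then \<open>w\<close> stays 1 and only the round count may stop \<open>\<sigma>\<close>; hence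
  the first bound asks for B > 0.\<close>

lemma runs_base:
  assumes inp: "holds_input m n a b c s" and B: "nmem s ''B'' 0 = B" and L: "nmem s ''L'' 0 = L" "L \<le> m"
  shows "runs (base_com r) s (m * (4 * B + 9) + 7) (\<lambda>s'. \<exists>\<sigma>. nmem s' ''g'' 0 = r + \<sigma> \<and> \<sigma> \<le> m \<and>
    (B > 0 \<longrightarrow> L \<le> 2 ^ (\<sigma> * B)) \<and> (\<sigma> > 0 \<longrightarrow> 2 ^ ((\<sigma> - 1) * B) < L))"
proof -
  let ?dbl = "NSet ''w'' (NConst 0) (NAdd (reg ''w'') (reg ''w''))"
  let ?body = "Cond (NLess (reg ''w'') (reg ''L''))
         (Seq (For ''t'' (reg ''B'') ?dbl)
           (NSet ''g'' (NConst 0) (NAdd (reg ''g'') (NConst 1)))) Skip"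
  let ?I = "\<lambda>k s'. \<exists>\<sigma>. nmem s' ''w'' 0 = 2 ^ (\<sigma> * B) \<and> nmem s' ''g'' 0 = r + \<sigma> \<and> \<sigma> \<le> k \<and>
    (L \<le> 2 ^ (\<sigma> * B) \<or> \<sigma> = k) \<and> (\<sigma> > 0 \<longrightarrow> 2 ^ ((\<sigma> - 1) * B) < L)"
  have dbl: "runs (For ''t'' (reg ''B'') ?dbl) s1 (4 * B + 3)
      (\<lambda>s'. nmem s' ''w'' 0 = nmem s1 ''w'' 0 * 2 ^ B)" if B1: "nmem s1 ''B'' 0 = B" for s1
  proof (rule runs_For[where I = "\<lambda>k s'. nmem s' ''w'' 0 = nmem s1 ''w'' 0 * 2 ^ k" and K = 1])
    fix s' assume "agree (insert ''t'' (writes ?dbl)) s1 s'"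
    from agree_nmem[OF this, of "''B''"] B1 show "nval (reg ''B'') s' = B" by simp
  qed (auto intro!: runs_NSet)
  have loop: "runs (For ''i'' (reg ''m'') ?body) s1 (m * (4 * B + 9) + 3) (?I m)"
    if inp1: "holds_input m n a b c s1" and s1: "nmem s1 ''g'' 0 = r" "nmem s1 ''w'' 0 = 1"
      "nmem s1 ''B'' 0 = B" "nmem s1 ''L'' 0 = L" for s1
  proof (rule runs_For[where I = ?I and K = "4 * B + 6"])
    fix k s'
    assume k: "k < m" "?I k s'" and ag: "agree (insert ''i'' (writes ?body)) s1 s'"
    from k obtain \<sigma> where \<sigma>: "nmem s' ''w'' 0 = 2 ^ (\<sigma> * B)" "nmem s' ''g'' 0 = r + \<sigma>" "\<sigma> \<le> k"
      "L \<le> 2 ^ (\<sigma> * B) \<or> \<sigma> = k" "\<sigma> > 0 \<longrightarrow> 2 ^ ((\<sigma> - 1) * B) < L" by blast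
    have s': "nmem s' ''B'' 0 = B" "nmem s' ''L'' 0 = L"
      using agree_nmem[OF ag, of "''B''"] agree_nmem[OF ag, of "''L''"] s1 by simp_all
    show "runs ?body s' (4 * B + 6) (\<lambda>s''. ?I (Suc k) (set_ncell ''i'' 0 (Suc k) s''))"
    proof (rule runs_Cond[where N = "4 * B + 5"])
      assume lt: "bval (NLess (reg ''w'') (reg ''L'')) s'"
      have *: "?I (Suc k) (set_ncell ''i'' 0 (Suc k) (set_ncell ''g'' 0 (nmem s'' ''g'' 0 + 1) s''))"
        if "nmem s'' ''w'' 0 = nmem s' ''w'' 0 * 2 ^ B" "nmem s'' ''g'' = nmem s' ''g''" for s''
        using that \<sigma> lt s' by (intro exI[of _ "Suc \<sigma>"]) (auto simp: power_add mult.commute)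
      show "runs (Seq (For ''t'' (reg ''B'') ?dbl) (NSet ''g'' (NConst 0) (NAdd (reg ''g'') (NConst 1))))
        s' (4 * B + 5) (\<lambda>s''. ?I (Suc k) (set_ncell ''i'' 0 (Suc k) s''))"
      proof (rule runs_Seq[where M = "4 * B + 3" and N = 1])
        show "runs (For ''t'' (reg ''B'') ?dbl) s' (4 * B + 3)
          (\<lambda>s''. agree (writes (For ''t'' (reg ''B'') ?dbl)) s' s'' \<longrightarrow>
            runs (NSet ''g'' (NConst 0) (NAdd (reg ''g'') (NConst 1))) s'' 1
              (\<lambda>s''. ?I (Suc k) (set_ncell ''i'' 0 (Suc k) s'')))"
        proof (rule runs_weaken[OF dbl[OF s'(1)]], simp, intro impI runs_NSet)
          fix s'' assume w: "nmem s'' ''w'' 0 = nmem s' ''w'' 0 * 2 ^ B"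
            and ag: "agree (writes (For ''t'' (reg ''B'') ?dbl)) s' s''"
          have "nmem s'' ''g'' = nmem s' ''g''" by (rule agree_nmem[OF ag]) simp
          from *[OF w this] show "?I (Suc k) (set_ncell ''i'' 0 (Suc k)
             (set_ncell ''g'' (nval (NConst 0) s'') (nval (NAdd (reg ''g'') (NConst 1)) s'') s''))"
            by simp
        qed simp
      qed simp
    next
      assume "\<not> bval (NLess (reg ''w'') (reg ''L'')) s'"
      then show "runs Skip s' (4 * B + 5) (\<lambda>s''. ?I (Suc k) (set_ncell ''i'' 0 (Suc k) s''))"
        using \<sigma> s' by (intro runs_Skip exI[of _ \<sigma>]) auto
    qed simp
  next
    fix s' assume "agree (insert ''i'' (writes ?body)) s1 s'"
    from holds_input_agree[OF this inp1] show "nval (reg ''m'') s' = m"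
      by (simp add: holds_input_def)
  qed (use s1 in auto)
  have fin: "\<exists>\<sigma>. nmem s' ''g'' 0 = r + \<sigma> \<and> \<sigma> \<le> m \<and>
    (B > 0 \<longrightarrow> L \<le> 2 ^ (\<sigma> * B)) \<and> (\<sigma> > 0 \<longrightarrow> 2 ^ ((\<sigma> - 1) * B) < L)" if "?I m s'" for s'
  proof -
    \<comment> \<open>Settles the alternative \<sigma> = m of the invariant: \<open>m\<close> rounds
      are always enough.\<close>
    have "L \<le> 2 ^ (m * B)" if "B > 0"
    proof -
      have "L \<le> 2 ^ m" using L(2) less_exp[of m] by linarith
      also have "(2::nat) ^ m \<le> 2 ^ (m * B)" using \<open>B > 0\<close> by (intro power_increasing) auto
      finally show ?thesis .
    qed
    with that show ?thesis by blast
  qed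
  show ?thesis unfolding base_com_def
    by (intro runs_Seq[where M = 1 and N = "m * (4 * B + 9) + 5"]
        runs_Seq[where M = 1 and N = "m * (4 * B + 9) + 3"]
        runs_NSet impI runs_weaken[OF loop _ fin]) (use inp B L in \<open>auto simp: holds_input_def\<close>)
qed

lemma runs_table:
  assumes inp: "holds_input m n a b c s" and B: "nmem s ''B'' 0 = B" and g: "nmem s ''g'' 0 = g"
  shows "runs table_com s (4 * n + 3 + (B * (n * (4 * g + 8) + 6) + 3) + 1)
    (\<lambda>s'. \<forall>u\<le>B. \<forall>j<n. rmem s' ''q'' u j = (2 ^ g) ^ u * c j)"
proof -
  let ?init = "RSet ''q'' (NConst 0) (reg ''j'') (RCell ''c'' (NConst 0) (reg ''j''))"
  let ?dbl = "RSet ''q'' (NAdd (reg ''a'') (NConst 1)) (reg ''j'')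
             (RScale 2 (RCell ''q'' (NAdd (reg ''a'') (NConst 1)) (reg ''j'')))"
  let ?cp = "RSet ''q'' (NAdd (reg ''a'') (NConst 1)) (reg ''j'') (RCell ''q'' (reg ''a'') (reg ''j''))"
  let ?inner = "For ''t'' (reg ''g'') ?dbl"
  let ?row = "For ''j'' (reg ''n'') (Seq ?cp ?inner)"
  have init: "runs (For ''j'' (reg ''n'') ?init) s (4 * n + 3) (\<lambda>s'. \<forall>j<n. rmem s' ''q'' 0 j = c j)"
  proof (rule runs_For[where I = "\<lambda>k s'. \<forall>j<k. rmem s' ''q'' 0 j = c j" and K = 1])
    fix k s' assume k: "\<forall>j<k. rmem s' ''q'' 0 j = c j" "nmem s' ''j'' 0 = k"
      and ag: "agree (insert ''j'' (writes ?init)) s s'"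
    have "rmem s' ''c'' 0 = c" using holds_input_agree[OF ag inp] by (simp add: holds_input_def)
    with k show "runs ?init s' 1 (\<lambda>s''. \<forall>j<Suc k. rmem (set_ncell ''j'' 0 (Suc k) s'') ''q'' 0 j = c j)"
      by (intro runs_RSet) (auto simp: less_Suc_eq)
  next
    fix s' assume "agree (insert ''j'' (writes ?init)) s s'"
    from holds_input_agree[OF this inp] show "nval (reg ''n'') s' = n" by (simp add: holds_input_def)
  qed auto
  \<comment> \<open>Stated as an update of the whole array, which records that all other entries
    survive.\<close>
  have inner: "runs ?inner s1 (4 * g + 3)
      (\<lambda>s'. rmem s' ''q'' = (rmem s1 ''q'')(Suc u := (rmem s1 ''q'' (Suc u))(j := 2 ^ g * rmem s1 ''q'' (Suc u) j)))"
    if s1: "nmem s1 ''a'' 0 = u" "nmem s1 ''j'' 0 = j" "nmem s1 ''g'' 0 = g" for s1 u j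
  proof (rule runs_For[where I = "\<lambda>k s'. rmem s' ''q'' =
      (rmem s1 ''q'')(Suc u := (rmem s1 ''q'' (Suc u))(j := 2 ^ k * rmem s1 ''q'' (Suc u) j))" and K = 1])
    fix k s' assume k: "rmem s' ''q'' =
        (rmem s1 ''q'')(Suc u := (rmem s1 ''q'' (Suc u))(j := 2 ^ k * rmem s1 ''q'' (Suc u) j))"
      and ag: "agree (insert ''t'' (writes ?dbl)) s1 s'"
    have "nmem s' ''a'' 0 = u" "nmem s' ''j'' 0 = j"
      using agree_nmem[OF ag, of "''a''"] agree_nmem[OF ag, of "''j''"] s1 by simp_all
    with k show "runs ?dbl s' 1 (\<lambda>s''. rmem (set_ncell ''t'' 0 (Suc k) s'') ''q'' =
        (rmem s1 ''q'')(Suc u := (rmem s1 ''q'' (Suc u))(j := 2 ^ Suc k * rmem s1 ''q'' (Suc u) j)))"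
      by (intro runs_RSet) (simp_all add: rmem_set_rcell mult.assoc)
  next
    fix s' assume "agree (insert ''t'' (writes ?dbl)) s1 s'"
    from agree_nmem[OF this, of "''g''"] s1 show "nval (reg ''g'') s' = g" by simp
  qed auto
  have row: "runs ?row s1 (n * (4 * g + 8) + 3)
      (\<lambda>s'. (\<forall>v\<le>u. rmem s' ''q'' v = rmem s1 ''q'' v) \<and>
        (\<forall>j<n. rmem s' ''q'' (Suc u) j = 2 ^ g * rmem s1 ''q'' u j))"
    if inp1: "holds_input m n a b c s1" and s1: "nmem s1 ''a'' 0 = u" "nmem s1 ''g'' 0 = g" for s1 u
  proof (rule runs_For[where I = "\<lambda>k s'. (\<forall>v\<le>u. rmem s' ''q'' v = rmem s1 ''q'' v) \<and>
        (\<forall>j<k. rmem s' ''q'' (Suc u) j = 2 ^ g * rmem s1 ''q'' u j)" and K = "4 * g + 5"])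
    fix k s' assume k: "(\<forall>v\<le>u. rmem s' ''q'' v = rmem s1 ''q'' v) \<and>
        (\<forall>j<k. rmem s' ''q'' (Suc u) j = 2 ^ g * rmem s1 ''q'' u j)" "nmem s' ''j'' 0 = k"
      and ag: "agree (insert ''j'' (writes (Seq ?cp ?inner))) s1 s'"
    have s': "nmem s' ''a'' 0 = u" "nmem s' ''g'' 0 = g"
      using agree_nmem[OF ag, of "''a''"] agree_nmem[OF ag, of "''g''"] s1 by simp_all
    show "runs (Seq ?cp ?inner) s' (4 * g + 5) (\<lambda>s''.
        (\<forall>v\<le>u. rmem (set_ncell ''j'' 0 (Suc k) s'') ''q'' v = rmem s1 ''q'' v) \<and>
        (\<forall>j<Suc k. rmem (set_ncell ''j'' 0 (Suc k) s'') ''q'' (Suc u) j = 2 ^ g * rmem s1 ''q'' u j))"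
    proof (rule runs_Seq[where M = 1 and N = "4 * g + 3"], rule runs_RSet, rule impI)
      let ?s = "set_rcell ''q'' (nval (NAdd (reg ''a'') (NConst 1)) s') (nval (reg ''j'') s')
        (rval (RCell ''q'' (reg ''a'') (reg ''j'')) s') s'"
      have s: "rmem ?s ''q'' = (rmem s' ''q'')(Suc u := (rmem s' ''q'' (Suc u))(k := rmem s' ''q'' u k))"
        using s' k(2) by (simp add: rmem_set_rcell)
      have "nmem ?s ''a'' 0 = u" "nmem ?s ''j'' 0 = k" "nmem ?s ''g'' 0 = g" using s' k(2) by simp_all
      from inner[OF this]
      show "runs ?inner ?s (4 * g + 3) (\<lambda>s''.
        (\<forall>v\<le>u. rmem (set_ncell ''j'' 0 (Suc k) s'') ''q'' v = rmem s1 ''q'' v) \<and>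
        (\<forall>j<Suc k. rmem (set_ncell ''j'' 0 (Suc k) s'') ''q'' (Suc u) j = 2 ^ g * rmem s1 ''q'' u j))"
      proof (rule runs_weaken[OF _ order_refl])
        fix s'' :: state assume *: "rmem s'' ''q'' = (rmem ?s ''q'')(Suc u :=
          (rmem ?s ''q'' (Suc u))(k := 2 ^ g * rmem ?s ''q'' (Suc u) k))"
        have "\<forall>v\<le>u. rmem s'' ''q'' v = rmem s1 ''q'' v"
          "\<forall>j<Suc k. rmem s'' ''q'' (Suc u) j = 2 ^ g * rmem s1 ''q'' u j"
          unfolding * s using k(1) by (auto simp: less_Suc_eq)
        then show "(\<forall>v\<le>u. rmem (set_ncell ''j'' 0 (Suc k) s'') ''q'' v = rmem s1 ''q'' v) \<and>
          (\<forall>j<Suc k. rmem (set_ncell ''j'' 0 (Suc k) s'') ''q'' (Suc u) j = 2 ^ g * rmem s1 ''q'' u j)"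
          by simp
      qed
    qed auto
  next
    fix s' assume "agree (insert ''j'' (writes (Seq ?cp ?inner))) s1 s'"
    from holds_input_agree[OF this inp1] show "nval (reg ''n'') s' = n" by (simp add: holds_input_def)
  qed auto
  have rows: "runs (For ''a'' (reg ''B'') ?row) s1 (B * (n * (4 * g + 8) + 6) + 3)
      (\<lambda>s'. \<forall>u\<le>B. \<forall>j<n. rmem s' ''q'' u j = (2 ^ g) ^ u * c j)"
    if inp1: "holds_input m n a b c s1" and s1: "nmem s1 ''B'' 0 = B" "nmem s1 ''g'' 0 = g"
      "\<forall>j<n. rmem s1 ''q'' 0 j = c j" for s1
  proof (rule runs_For[where I = "\<lambda>k s'. \<forall>u\<le>k. \<forall>j<n. rmem s' ''q'' u j = (2 ^ g) ^ u * c j"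
      and K = "n * (4 * g + 8) + 3"])
    fix k s' assume k: "\<forall>u\<le>k. \<forall>j<n. rmem s' ''q'' u j = (2 ^ g) ^ u * c j" "nmem s' ''a'' 0 = k"
      and ag: "agree (insert ''a'' (writes ?row)) s1 s'"
    have inp': "holds_input m n a b c s'" using holds_input_agree[OF ag inp1] by simp
    have g': "nmem s' ''g'' 0 = g" using agree_nmem[OF ag, of "''g''"] s1 by simp
    show "runs ?row s' (n * (4 * g + 8) + 3) (\<lambda>s''. \<forall>u\<le>Suc k. \<forall>j<n.
        rmem (set_ncell ''a'' 0 (Suc k) s'') ''q'' u j = (2 ^ g) ^ u * c j)"
    proof (rule runs_weaken[OF row[OF inp' k(2) g'] order_refl], elim conjE)
      fix s'' :: state assume "\<forall>v\<le>k. rmem s'' ''q'' v = rmem s' ''q'' v"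
        and "\<forall>j<n. rmem s'' ''q'' (Suc k) j = 2 ^ g * rmem s' ''q'' k j"
      then have "rmem s'' ''q'' u j = (2 ^ g) ^ u * c j" if "u \<le> Suc k" "j < n" for u j
        using k(1) that by (cases "u = Suc k") simp_all
      then show "\<forall>u\<le>Suc k. \<forall>j<n. rmem (set_ncell ''a'' 0 (Suc k) s'') ''q'' u j = (2 ^ g) ^ u * c j"
        by simp
    qed
  next
    fix s' assume "agree (insert ''a'' (writes ?row)) s1 s'"
    from agree_nmem[OF this, of "''B''"] s1 show "nval (reg ''B'') s' = B" by simp
  qed (use s1 in auto)
  show ?thesis unfolding table_com_def
  proof (rule runs_Seq[where M = "4 * n + 3"], rule runs_weaken[OF init order_refl], rule impI)
    fix s' assume q: "\<forall>j<n. rmem s' ''q'' 0 j = c j"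
      and ag: "agree (writes (For ''j'' (reg ''n'') ?init)) s s'"
    have "holds_input m n a b c s'" using holds_input_agree[OF ag inp] by simp
    moreover have "nmem s' ''B'' 0 = B" "nmem s' ''g'' 0 = g"
      using agree_nmem[OF ag, of "''B''"] agree_nmem[OF ag, of "''g''"] B g by simp_all
    ultimately show "runs (For ''a'' (reg ''B'') ?row) s' (B * (n * (4 * g + 8) + 6) + 3)
      (\<lambda>s'. \<forall>u\<le>B. \<forall>j<n. rmem s' ''q'' u j = (2 ^ g) ^ u * c j)" using q by (rule rows)
  qed simp
qed

section \<open>Correctness of the greedy loop\<close>

definition pos_rows :: "nat \<Rightarrow> (nat \<Rightarrow> nat \<Rightarrow> real) \<Rightarrow> nat \<Rightarrow> nat set" where
  "pos_rows m a j = {i. i < m \<and> 0 < a i j}"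

lemma sum_columns_Suc:
  "sum h {i. i < Suc k \<and> 0 < (a i j :: real)} =
    sum h {i. i < k \<and> 0 < a i j} + (if 0 < a k j then h k else (0::real))"
proof -
  have "{i. i < Suc k \<and> 0 < a i j} =
      (if 0 < a k j then insert k {i. i < k \<and> 0 < a i j} else {i. i < k \<and> 0 < a i j})"
    by (auto simp: less_Suc_eq)
  then show ?thesis by simp
qed

lemma runs_compare:
  assumes inp: "holds_input m n a b c s" and jl: "nmem s ''j'' 0 = j" "nmem s ''l'' 0 = l"
  shows "runs compare_com s (8 * m + 7) (\<lambda>s'.
    rmem s' ''p'' 0 0 = (\<Sum>i\<in>pos_rows m a j. rmem s ''q'' (nmem s ''u'' i) l) \<and>
    rmem s' ''r'' 0 0 = (\<Sum>i\<in>pos_rows m a l. rmem s ''q'' (nmem s ''u'' i) j))"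
proof -
  let ?c1 = "Cond (entry_pos (reg ''i'') (reg ''j''))
           (RSet ''p'' (NConst 0) (NConst 0)
             (RAdd (rreg ''p'') (RCell ''q'' (NCell ''u'' (reg ''i'')) (reg ''l'')))) Skip"
  let ?c2 = "Cond (entry_pos (reg ''i'') (reg ''l''))
           (RSet ''r'' (NConst 0) (NConst 0)
             (RAdd (rreg ''r'') (RCell ''q'' (NCell ''u'' (reg ''i'')) (reg ''j'')))) Skip"
  let ?h1 = "\<lambda>i. rmem s ''q'' (nmem s ''u'' i) l" and ?h2 = "\<lambda>i. rmem s ''q'' (nmem s ''u'' i) j"
  let ?I = "\<lambda>k s'. rmem s' ''p'' 0 0 = sum ?h1 {i. i < k \<and> 0 < a i j} \<and>
    rmem s' ''r'' 0 0 = sum ?h2 {i. i < k \<and> 0 < a i l}"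
  have loop: "runs (For ''i'' (reg ''m'') (Seq ?c1 ?c2)) s1 (8 * m + 3) (?I m)"
    if s1: "agree {''p'', ''r''} s s1" "rmem s1 ''p'' 0 0 = 0" "rmem s1 ''r'' 0 0 = 0" for s1
  proof (rule runs_For[where I = ?I and K = 5])
    fix k s' assume k: "?I k s'" "nmem s' ''i'' 0 = k"
      and ag1: "agree (insert ''i'' (writes (Seq ?c1 ?c2))) s1 s'"
    have ag: "agree {''i'', ''p'', ''r''} s s'"
      by (rule agree_trans[OF s1(1) ag1]) auto
    have s': "nmem s' ''j'' 0 = j" "nmem s' ''l'' 0 = l" "rmem s' ''q'' = rmem s ''q''"
        "nmem s' ''u'' = nmem s ''u''"
      using agree_nmem[OF ag, of "''j''"] agree_nmem[OF ag, of "''l''"] agree_rmem[OF ag, of "''q''"]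
        agree_nmem[OF ag, of "''u''"] jl by simp_all
    have a: "rmem s' ''A'' = a" using holds_input_agree[OF ag inp] by (simp add: holds_input_def)
    show "runs (Seq ?c1 ?c2) s' 5 (\<lambda>s''. ?I (Suc k) (set_ncell ''i'' 0 (Suc k) s''))"
      by (intro runs_Seq[where M = 2 and N = 2] runs_Cond[where N = 1] runs_RSet runs_Skip impI)
        (use k s' a in \<open>simp_all add: sum_columns_Suc\<close>)
  next
    fix s' assume ag1: "agree (insert ''i'' (writes (Seq ?c1 ?c2))) s1 s'"
    have ag: "agree {''i'', ''p'', ''r''} s s'"
      by (rule agree_trans[OF s1(1) ag1]) auto
    from holds_input_agree[OF ag inp] show "nval (reg ''m'') s' = m" by (simp add: holds_input_def)
  qed (use s1 in auto)
  show ?thesis unfolding compare_com_def pos_rows_def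
    by (intro runs_Seq[where M = 1 and N = "8 * m + 5"] runs_Seq[where M = 1 and N = "8 * m + 3"]
      runs_RSet impI loop) (auto simp: agree_def rmem_set_rcell)
qed

text \<open>Turns sums of table entries into prices. The loads must be at most \<open>B\<close>,
  where the table ends.\<close>

lemma price_pos_rows:
  assumes "\<forall>u\<le>B. \<forall>j<n. q u j = \<beta> ^ u * c j" "l < n" "\<And>i. u i \<le> B"
  shows "(\<Sum>i\<in>pos_rows m a j. q (u i) l) = c l * price \<beta> (pos_rows m a) u j"
  using assms by (simp add: price_def sum_distrib_left mult.commute)

text \<open>A linear scan for the maximal ratio. Some untreated column is returned whatever the
  values are, because of \<open>j0\<close>; its maximality rests on transitivity of the comparison,
  hence on positive values.\<close>

lemma runs_pick:
  assumes inp: "holds_input m n a b c s" and q: "\<forall>u\<le>B. \<forall>j<n. rmem s ''q'' u j = \<beta> ^ u * c j"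
    and u: "\<And>i. nmem s ''u'' i \<le> B" and j0: "j0 < n" "nmem s ''f'' j0 = 0" and \<beta>: "\<beta> > 0"
  shows "runs pick_com s (n * (8 * m + 13) + 5) (\<lambda>s'. let l = nmem s' ''l'' 0 in
    l < n \<and> nmem s ''f'' l = 0 \<and> ((\<forall>j<n. c j > 0) \<longrightarrow> (\<forall>j<n. nmem s ''f'' j = 0 \<longrightarrow>
      c j * price \<beta> (pos_rows m a) (nmem s ''u'') l \<le> c l * price \<beta> (pos_rows m a) (nmem s ''u'') j)))"
proof -
  let ?S = "price \<beta> (pos_rows m a) (nmem s ''u'')"
  let ?sel = "Cond (BAnd (NLess (NCell ''f'' (reg ''j'')) (NConst 1))
           (BNot (BAnd (NLess (reg ''l'') (reg ''n'')) (BNot (RLess (rreg ''p'') (rreg ''r''))))))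
         (NSet ''l'' (NConst 0) (reg ''j'')) Skip"
  let ?best = "\<lambda>k l. l < n \<and> nmem s ''f'' l = 0 \<and> ((\<forall>j<n. c j > 0) \<longrightarrow>
      (\<forall>j<k. nmem s ''f'' j = 0 \<longrightarrow> c j * ?S l \<le> c l * ?S j))"
  let ?I = "\<lambda>k s'. (nmem s' ''l'' 0 = n \<and> (\<forall>j<k. nmem s ''f'' j \<noteq> 0)) \<or> ?best k (nmem s' ''l'' 0)"
  have S0: "?S j \<ge> 0" for j using \<beta> by (intro price_nonneg) auto
  have keep: "?best (Suc k) l" if "?best k l" "nmem s ''f'' k = 0 \<longrightarrow> c k * ?S l \<le> c l * ?S k" for k l
    using that by (auto simp: less_Suc_eq)
  have new: "?best (Suc k) k" if k: "k < n" "nmem s ''f'' k = 0" and l: "?best k l" "c l * ?S k < c k * ?S l"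
    for k l
  proof -
    have "c j * ?S k \<le> c k * ?S j" if c: "\<forall>j<n. c j > 0" and j: "j < k" "nmem s ''f'' j = 0" for j
    proof -
      have pos: "c l > 0" "c j > 0" "c k > 0" using c l(1) j k by auto
      have "c l * (c j * ?S k) = c j * (c l * ?S k)" by simp
      also have "\<dots> \<le> c j * (c k * ?S l)" using l(2) pos by (intro mult_left_mono) auto
      also have "\<dots> = c k * (c j * ?S l)" by simp
      also have "\<dots> \<le> c k * (c l * ?S j)" using l(1) c j pos by (intro mult_left_mono) auto
      also have "\<dots> = c l * (c k * ?S j)" by simp
      \<comment> \<open>The factor cancelled is \<open>c l\<close>, not a price: the price of an
        empty column is 0, which ranks it highest.\<close>
      finally show ?thesis using pos by (simp only: mult_le_cancel_left_pos)
    qed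
    then show ?thesis using k by (auto simp: less_Suc_eq)
  qed
  have loop: "runs (For ''j'' (reg ''n'') (Seq compare_com ?sel)) s1 (n * (8 * m + 13) + 3) (?I n)"
    if s1: "agree {''l''} s s1" "nmem s1 ''l'' 0 = n" for s1
  proof (rule runs_For[where I = ?I and K = "8 * m + 10"])
    fix k s' assume k: "k < n" "?I k s'" "nmem s' ''j'' 0 = k"
      and ag1: "agree (insert ''j'' (writes (Seq compare_com ?sel))) s1 s'"
    have ag: "agree {''l'', ''j'', ''p'', ''r'', ''i''} s s'"
      by (rule agree_trans[OF s1(1) ag1]) auto
    have inp': "holds_input m n a b c s'" using holds_input_agree[OF ag inp] by simp
    have s': "rmem s' ''q'' = rmem s ''q''" "nmem s' ''u'' = nmem s ''u''" "nmem s' ''f'' = nmem s ''f''"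
      using agree_rmem[OF ag, of "''q''"] agree_nmem[OF ag, of "''u''"] agree_nmem[OF ag, of "''f''"]
      by simp_all
    define l where "l = nmem s' ''l'' 0"
    show "runs (Seq compare_com ?sel) s' (8 * m + 10) (\<lambda>s''. ?I (Suc k) (set_ncell ''j'' 0 (Suc k) s''))"
    proof (rule runs_Seq[where N = 2], rule runs_weaken[OF runs_compare[OF inp' k(3)] order_refl],
        rule l_def[symmetric], rule impI, erule conjE)
      fix s'' assume pr: "rmem s'' ''p'' 0 0 = (\<Sum>i\<in>pos_rows m a k. rmem s' ''q'' (nmem s' ''u'' i) l)"
          "rmem s'' ''r'' 0 0 = (\<Sum>i\<in>pos_rows m a l. rmem s' ''q'' (nmem s' ''u'' i) k)"
        and ag2: "agree (writes compare_com) s' s''"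
      have s'': "nmem s'' ''l'' 0 = l" "nmem s'' ''j'' 0 = k" "nmem s'' ''f'' = nmem s ''f''"
        using agree_nmem[OF ag2, of "''l''"] agree_nmem[OF ag2, of "''j''"]
          agree_nmem[OF ag2, of "''f''"] k s' by (simp_all add: l_def)
      have n'': "nmem s'' ''n'' 0 = n"
        using holds_input_agree[OF ag2 inp'] by (simp add: holds_input_def)
      \<comment> \<open>As long as no column is chosen, \<open>p\<close> has no meaning, but then
        the outcome of the test does not depend on it.\<close>
      have p: "rmem s'' ''p'' 0 0 = c l * ?S k" if "l < n"
        using price_pos_rows[OF q that u] pr(1) s' by simp
      have r: "rmem s'' ''r'' 0 0 = c k * ?S l"
        using price_pos_rows[OF q k(1) u] pr(2) s' by simp
      have l: "l = n \<and> (\<forall>j<k. nmem s ''f'' j \<noteq> 0) \<or> ?best k l" using k(2) by (simp add: l_def)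
      show "runs ?sel s'' 2 (\<lambda>s''. ?I (Suc k) (set_ncell ''j'' 0 (Suc k) s''))"
      proof (intro runs_Cond[where N = 1] runs_NSet runs_Skip)
        assume "bval (BAnd (NLess (NCell ''f'' (reg ''j'')) (NConst 1))
           (BNot (BAnd (NLess (reg ''l'') (reg ''n'')) (BNot (RLess (rreg ''p'') (rreg ''r'')))))) s''"
        then have f: "nmem s ''f'' k = 0" and "l < n \<longrightarrow> c l * ?S k < c k * ?S l"
          using p r s'' n'' by auto
        then have "?best (Suc k) k"
          using l new[OF k(1) f] k(1) by (elim disjE) (auto simp: less_Suc_eq)
        then show "?I (Suc k) (set_ncell ''j'' 0 (Suc k) (set_ncell ''l'' (nval (NConst 0) s'')
            (nval (reg ''j'') s'') s''))"
          using s'' by simp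
      next
        assume "\<not> bval (BAnd (NLess (NCell ''f'' (reg ''j'')) (NConst 1))
           (BNot (BAnd (NLess (reg ''l'') (reg ''n'')) (BNot (RLess (rreg ''p'') (rreg ''r'')))))) s''"
        then have "nmem s ''f'' k \<noteq> 0 \<or> l < n \<and> c k * ?S l \<le> c l * ?S k"
          using p r s'' n'' by auto
        then have "l = n \<and> (\<forall>j<Suc k. nmem s ''f'' j \<noteq> 0) \<or> ?best (Suc k) l"
        proof (cases "l < n")
          case True
          then have "?best k l" using l by auto
          moreover have "nmem s ''f'' k = 0 \<longrightarrow> c k * ?S l \<le> c l * ?S k"
            using \<open>nmem s ''f'' k \<noteq> 0 \<or> l < n \<and> c k * ?S l \<le> c l * ?S k\<close> by blast
          ultimately show ?thesis by (intro disjI2 keep)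
        next
          case False
          then have "l = n" "\<forall>j<k. nmem s ''f'' j \<noteq> 0" using l by auto
          moreover have "nmem s ''f'' k \<noteq> 0" 
            using \<open>nmem s ''f'' k \<noteq> 0 \<or> l < n \<and> c k * ?S l \<le> c l * ?S k\<close> False by blast
          ultimately show ?thesis by (auto simp: less_Suc_eq)
        qed
        then show "?I (Suc k) (set_ncell ''j'' 0 (Suc k) s'')" using s'' by simp
      qed auto
    qed simp
  next
    fix s' assume ag1: "agree (insert ''j'' (writes (Seq compare_com ?sel))) s1 s'"
    have ag: "agree {''l'', ''j'', ''p'', ''r'', ''i''} s s'"
      by (rule agree_trans[OF s1(1) ag1]) auto
    from holds_input_agree[OF ag inp] show "nval (reg ''n'') s' = n" by (simp add: holds_input_def)
  qed (use s1 in auto)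
  show ?thesis unfolding pick_com_def
  proof (rule runs_Seq[where M = 1 and N = "n * (8 * m + 13) + 3"], rule runs_NSet, rule impI)
    let ?s = "set_ncell ''l'' (nval (NConst 0) s) (nval (reg ''n'') s) s"
    have "agree {''l''} s ?s" by (simp add: agree_def nmem_set_ncell)
    moreover have "nmem ?s ''l'' 0 = n" using inp by (simp add: holds_input_def)
    ultimately have *: "runs (For ''j'' (reg ''n'') (Seq compare_com ?sel)) ?s
      (n * (8 * m + 13) + 3) (?I n)" by (rule loop)
    show "runs (For ''j'' (reg ''n'') (Seq compare_com ?sel)) ?s (n * (8 * m + 13) + 3)
      (\<lambda>s'. let l = nmem s' ''l'' 0 in ?best n l)"
    proof (rule runs_weaken[OF * order_refl])
      fix s' :: state assume "?I n s'"
      then have "?best n (nmem s' ''l'' 0)" using j0 by blast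
      then show "let l = nmem s' ''l'' 0 in ?best n l" unfolding Let_def .
    qed
  qed auto
qed

lemma runs_test:
  assumes inp: "holds_input m n a b c s" and l: "nmem s ''l'' 0 = l" and B: "nmem s ''B'' 0 = B"
  shows "runs test_com s (5 * m + 5) (\<lambda>s'.
    nmem s' ''k'' 0 = of_bool (\<forall>i\<in>pos_rows m a l. nmem s ''u'' i < B))"
proof -
  let ?body = "Cond (BAnd (entry_pos (reg ''i'') (reg ''l''))
           (BNot (NLess (NCell ''u'' (reg ''i'')) (reg ''B''))))
         (NSet ''k'' (NConst 0) (NConst 0)) Skip"
  let ?I = "\<lambda>k s'. nmem s' ''k'' 0 = of_bool (\<forall>i<k. 0 < a i l \<longrightarrow> nmem s ''u'' i < B)"
  have loop: "runs (For ''i'' (reg ''m'') ?body) s1 (5 * m + 3) (?I m)"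
    if s1: "agree {''k''} s s1" "nmem s1 ''k'' 0 = 1" for s1
  proof (rule runs_For[where I = ?I and K = 2])
    fix k s' assume k: "?I k s'" "nmem s' ''i'' 0 = k" and ag1: "agree (insert ''i'' (writes ?body)) s1 s'"
    have ag: "agree {''i'', ''k''} s s'" by (rule agree_trans[OF s1(1) ag1]) auto
    have "rmem s' ''A'' = a" using holds_input_agree[OF ag inp] by (simp add: holds_input_def)
    moreover have "nmem s' ''l'' 0 = l" "nmem s' ''B'' 0 = B" "nmem s' ''u'' = nmem s ''u''"
      using agree_nmem[OF ag, of "''l''"] agree_nmem[OF ag, of "''B''"] agree_nmem[OF ag, of "''u''"]
        l B by simp_all
    ultimately show "runs ?body s' 2 (\<lambda>s''. ?I (Suc k) (set_ncell ''i'' 0 (Suc k) s''))"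
      using k by (intro runs_Cond[where N = 1] runs_NSet runs_Skip) (auto simp: less_Suc_eq)
  next
    fix s' assume ag1: "agree (insert ''i'' (writes ?body)) s1 s'"
    have ag: "agree {''i'', ''k''} s s'" by (rule agree_trans[OF s1(1) ag1]) auto
    from holds_input_agree[OF ag inp] show "nval (reg ''m'') s' = m" by (simp add: holds_input_def)
  qed (use s1 in auto)
  show ?thesis unfolding test_com_def
    by (intro runs_Seq[where M = 1 and N = "5 * m + 3"] runs_NSet impI runs_weaken[OF loop])
      (auto simp: agree_def nmem_set_ncell pos_rows_def)
qed

lemma runs_update:
  assumes inp: "holds_input m n a b c s" and l: "nmem s ''l'' 0 = l"
  shows "runs update_com s (5 * m + 8) (\<lambda>s'.
    nmem s' ''f'' = (nmem s ''f'')(l := 1) \<and>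
    (if nmem s ''k'' 0 > 0 then
       nmem s' ''u'' = (\<lambda>i. if i \<in> pos_rows m a l then nmem s ''u'' i + 1 else nmem s ''u'' i) \<and>
       rmem s' ''y'' 0 = (rmem s ''y'' 0)(l := 1)
     else nmem s' ''u'' = nmem s ''u'' \<and> rmem s' ''y'' 0 = rmem s ''y'' 0))"
proof -
  let ?body = "Cond (entry_pos (reg ''i'') (reg ''l''))
             (NSet ''u'' (reg ''i'') (NAdd (NCell ''u'' (reg ''i'')) (NConst 1))) Skip"
  let ?I = "\<lambda>k s'. nmem s' ''u'' = (\<lambda>i. if i < k \<and> 0 < a i l then nmem s ''u'' i + 1 else nmem s ''u'' i)"
  have loop: "runs (For ''i'' (reg ''m'') ?body) s1 (5 * m + 3) (\<lambda>s'. ?I m s' \<and>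
      nmem s' ''f'' = nmem s1 ''f'' \<and> rmem s' ''y'' = rmem s1 ''y'')"
    if s1: "agree {''f'', ''y''} s s1" for s1
  proof (rule runs_weaken[OF runs_For[where I = ?I and K = 2]])
    fix k s' assume k: "?I k s'" "nmem s' ''i'' 0 = k" and ag1: "agree (insert ''i'' (writes ?body)) s1 s'"
    have ag: "agree {''f'', ''y'', ''i'', ''u''} s s'" by (rule agree_trans[OF s1(1) ag1]) auto
    have "rmem s' ''A'' = a" using holds_input_agree[OF ag inp] by (simp add: holds_input_def)
    moreover have "nmem s' ''l'' 0 = l" using agree_nmem[OF ag, of "''l''"] l by simp
    ultimately show "runs ?body s' 2 (\<lambda>s''. ?I (Suc k) (set_ncell ''i'' 0 (Suc k) s''))"
      using k by (intro runs_Cond[where N = 1] runs_NSet runs_Skip)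
        (auto simp: less_Suc_eq nmem_set_ncell fun_eq_iff)
  next
    fix s' assume ag1: "agree (insert ''i'' (writes ?body)) s1 s'"
    have ag: "agree {''f'', ''y'', ''i'', ''u''} s s'" by (rule agree_trans[OF s1(1) ag1]) auto
    from holds_input_agree[OF ag inp] show "nval (reg ''m'') s' = m" by (simp add: holds_input_def)
  next
    show "?I 0 (set_ncell ''i'' 0 0 s1)"
      using agree_nmem[OF s1, of "''u''"] by (simp add: nmem_set_ncell)
  next
    fix s' assume "?I m s'" and ag: "agree (writes (For ''i'' (reg ''m'') ?body)) s1 s'"
    then show "?I m s' \<and> nmem s' ''f'' = nmem s1 ''f'' \<and> rmem s' ''y'' = rmem s1 ''y''"
      using agree_nmem[OF ag, of "''f''"] agree_rmem[OF ag, of "''y''"] by simp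
  qed auto
  show ?thesis unfolding update_com_def
    by (intro runs_Seq[where M = 1 and N = "5 * m + 6"] runs_NSet impI runs_Cond[where N = "5 * m + 5"]
        runs_Seq[where M = 1 and N = "5 * m + 3"] runs_RSet runs_Skip runs_weaken[OF loop])
      (use l in \<open>auto simp: agree_def nmem_set_ncell rmem_set_rcell pos_rows_def\<close>)
qed

lemma runs_greedy:
  assumes inp: "holds_input m n a b c s" and q: "\<forall>u\<le>B. \<forall>j<n. rmem s ''q'' u j = \<beta> ^ u * c j"
    and B: "nmem s ''B'' 0 = B" and \<beta>: "\<beta> > 0"
    and init: "nmem s ''u'' = (\<lambda>_. 0)" "nmem s ''f'' = (\<lambda>_. 0)" "rmem s ''y'' 0 = (\<lambda>_. 0)"
  shows "runs greedy_com s (n * (n * (8 * m + 13) + 10 * m + 23) + 3) (\<lambda>s'. \<exists>u F.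
    greedy \<beta> B (pos_rows m a) c n u {..<n} F \<and> rmem s' ''y'' 0 = (\<lambda>j. of_bool (j \<in> F)))"
proof -
  let ?E = "pos_rows m a"
  \<comment> \<open>Counting the treated columns suffices: as \<open>R\<close> lies below
    \<open>n\<close>, fewer than \<open>n\<close> of them leave an untreated one for the next round,
    and \<open>n\<close> of them are all.\<close>
  define I where "I k s' \<longleftrightarrow> (\<exists>R F. card R = k \<and> greedy \<beta> B ?E c n (nmem s' ''u'') R F \<and>
    nmem s' ''f'' = (\<lambda>j. of_bool (j \<in> R)) \<and> rmem s' ''y'' 0 = (\<lambda>j. of_bool (j \<in> F)))"
    for k and s' :: state
  let ?body = "Seq pick_com (Seq test_com update_com)"
  have body: "runs ?body s0 (n * (8 * m + 13) + 10 * m + 20) (I (Suc k))"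
    if k: "k < n" "I k s0" and inp0: "holds_input m n a b c s0"
      and q0: "\<forall>u\<le>B. \<forall>j<n. rmem s0 ''q'' u j = \<beta> ^ u * c j" and B0: "nmem s0 ''B'' 0 = B" for k s0
  proof -
    define u where "u = nmem s0 ''u''"
    from k(2) obtain R F where R: "card R = k" and g: "greedy \<beta> B ?E c n u R F"
      and f: "nmem s0 ''f'' = (\<lambda>j. of_bool (j \<in> R))" and y: "rmem s0 ''y'' 0 = (\<lambda>j. of_bool (j \<in> F))"
      unfolding I_def u_def by blast
    have u: "nmem s0 ''u'' i \<le> B" for i using conjunct2[OF greedy_load[OF g, of i]] by (simp add: u_def)
    have RF: "R \<subseteq> {..<n}" "F \<subseteq> R" using greedy_subset[OF g] by auto
    then obtain j0 where j0: "j0 < n" "j0 \<notin> R"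
      using k(1) R card_mono[of R "{..<n}"] finite_subset[of R "{..<n}"] by fastforce
    have finR: "finite R" using RF finite_subset by blast
    show ?thesis
    proof (rule runs_Seq[where M = "n * (8 * m + 13) + 5" and N = "10 * m + 14"],
        rule runs_weaken[OF runs_pick[OF inp0 q0 u j0(1) _ \<beta>] order_refl])
      show "nmem s0 ''f'' j0 = 0" using j0 f by simp
      fix s1 :: state
      assume pick: "let l = nmem s1 ''l'' 0 in l < n \<and> nmem s0 ''f'' l = 0 \<and>
          ((\<forall>j<n. c j > 0) \<longrightarrow> (\<forall>j<n. nmem s0 ''f'' j = 0 \<longrightarrow>
            c j * price \<beta> ?E (nmem s0 ''u'') l \<le> c l * price \<beta> ?E (nmem s0 ''u'') j))"
        and ag1: "agree (writes pick_com) s0 s1"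
      define l where "l = nmem s1 ''l'' 0"
      have l: "l < n" "l \<notin> R" and best: "\<And>j. \<forall>j<n. c j > 0 \<Longrightarrow> j < n \<Longrightarrow> j \<notin> R \<Longrightarrow>
          c j * price \<beta> ?E u l \<le> c l * price \<beta> ?E u j"
        using pick f by (auto simp: Let_def l_def u_def)
      have inp1: "holds_input m n a b c s1" using holds_input_agree[OF ag1 inp0] by simp
      have s1: "nmem s1 ''B'' 0 = B" "nmem s1 ''u'' = u" "nmem s1 ''f'' = nmem s0 ''f''"
        "rmem s1 ''y'' = rmem s0 ''y''"
        using agree_nmem[OF ag1, of "''B''"] agree_nmem[OF ag1, of "''u''"]
          agree_nmem[OF ag1, of "''f''"] agree_rmem[OF ag1, of "''y''"] B0 by (simp_all add: u_def)
      show "agree (writes pick_com) s0 s1 \<longrightarrow> runs (Seq test_com update_com) s1 (10 * m + 14) (I (Suc k))"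
      proof (rule impI, rule runs_Seq[where M = "5 * m + 5" and N = "5 * m + 8"],
          rule runs_weaken[OF runs_test[OF inp1 l_def[symmetric] s1(1)] order_refl], rule impI)
        fix s2 :: state
        assume test: "nmem s2 ''k'' 0 = of_bool (\<forall>i\<in>?E l. nmem s1 ''u'' i < B)"
          and ag2: "agree (writes test_com) s1 s2"
        have inp2: "holds_input m n a b c s2" using holds_input_agree[OF ag2 inp1] by simp
        have s2: "nmem s2 ''l'' 0 = l" "nmem s2 ''u'' = u" "nmem s2 ''f'' = nmem s0 ''f''"
          "rmem s2 ''y'' = rmem s0 ''y''"
          using agree_nmem[OF ag2, of "''l''"] agree_nmem[OF ag2, of "''u''"]
            agree_nmem[OF ag2, of "''f''"] agree_rmem[OF ag2, of "''y''"] s1 by (simp_all add: l_def)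
        show "runs update_com s2 (5 * m + 8) (I (Suc k))"
        proof (rule runs_weaken[OF runs_update[OF inp2 s2(1)] order_refl], elim conjE)
          fix s3 :: state
          assume f3: "nmem s3 ''f'' = (nmem s2 ''f'')(l := 1)"
            and up: "if nmem s2 ''k'' 0 > 0 then
               nmem s3 ''u'' = (\<lambda>i. if i \<in> ?E l then nmem s2 ''u'' i + 1 else nmem s2 ''u'' i) \<and>
               rmem s3 ''y'' 0 = (rmem s2 ''y'' 0)(l := 1)
             else nmem s3 ''u'' = nmem s2 ''u'' \<and> rmem s3 ''y'' 0 = rmem s2 ''y'' 0"
          have f3': "nmem s3 ''f'' = (\<lambda>j. of_bool (j \<in> insert l R))"
            using f3 s2 f by (auto simp: fun_eq_iff)
          have cardR: "card (insert l R) = Suc k" using l finR R by simp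
          show "I (Suc k) s3"
          proof (cases "\<forall>i\<in>?E l. u i < B")
            case True
            then have "nmem s3 ''u'' = (\<lambda>i. if i \<in> ?E l then u i + 1 else u i)"
              "rmem s3 ''y'' 0 = (\<lambda>j. of_bool (j \<in> insert l F))"
              using up test s1 s2 y by (auto simp: fun_eq_iff)
            moreover have "greedy \<beta> B ?E c n (\<lambda>i. if i \<in> ?E l then u i + 1 else u i)
                (insert l R) (insert l F)"
              using True by (intro greedy.accept[OF g l best]) auto
            ultimately show ?thesis unfolding I_def using f3' cardR
              by (intro exI[of _ "insert l R"] exI[of _ "insert l F"]) simp
          next
            case False
            then have "nmem s3 ''u'' = u" "rmem s3 ''y'' 0 = (\<lambda>j. of_bool (j \<in> F))"
              using up test s1 s2 y by auto
            moreover have "greedy \<beta> B ?E c n u (insert l R) F"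
              using False greedy.reject[OF g l(1)] by (auto simp: not_less)
            ultimately show ?thesis unfolding I_def using f3' cardR
              by (intro exI[of _ "insert l R"] exI[of _ F]) simp
          qed
        qed
      qed simp
    qed simp
  qed
  have I_set: "I k (set_ncell ''a'' 0 v s') = I k s'" for k v s'
    by (simp add: I_def nmem_set_ncell)
  show ?thesis unfolding greedy_com_def
  proof (rule runs_weaken[OF runs_For[where I = I and N = n and K = "n * (8 * m + 13) + 10 * m + 20"]])
    have "I 0 s" unfolding I_def using init greedy.start[of \<beta> B ?E c n]
      by (intro exI[of _ "{}"]) auto
    then show "I 0 (set_ncell ''a'' 0 0 s)" by (simp add: I_set)
  next
    fix k s' assume k: "k < n" "I k s'" and ag: "agree (insert ''a'' (writes ?body)) s s'"
    have "holds_input m n a b c s'" using holds_input_agree[OF ag inp] by simp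
    moreover have "\<forall>u\<le>B. \<forall>j<n. rmem s' ''q'' u j = \<beta> ^ u * c j" "nmem s' ''B'' 0 = B"
      using agree_rmem[OF ag, of "''q''"] agree_nmem[OF ag, of "''B''"] q B by simp_all
    ultimately have "runs ?body s' (n * (8 * m + 13) + 10 * m + 20) (I (Suc k))"
      by (rule body[OF k])
    then show "runs ?body s' (n * (8 * m + 13) + 10 * m + 20)
        (\<lambda>s''. I (Suc k) (set_ncell ''a'' 0 (Suc k) s''))" by (simp add: I_set)
  next
    fix s' assume "agree (insert ''a'' (writes ?body)) s s'"
    from holds_input_agree[OF this inp] show "nval (reg ''n'') s' = n" by (simp add: holds_input_def)
  next
    fix s' :: state assume "I n s'"
    then obtain R F where R: "card R = n" and g: "greedy \<beta> B ?E c n (nmem s' ''u'') R F"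
      and y: "rmem s' ''y'' 0 = (\<lambda>j. of_bool (j \<in> F))" unfolding I_def by blast
    have "R = {..<n}" using greedy_subset[OF g] R by (intro card_subset_eq) auto
    with g y show "\<exists>u F. greedy \<beta> B ?E c n u {..<n} F \<and> rmem s' ''y'' 0 = (\<lambda>j. of_bool (j \<in> F))"
      by blast
  qed auto
qed

text \<open>The five phases and four units for \<open>Seq\<close>, with \<open>B\<close> replaced by
  its cap m + n and \<open>\<sigma>\<close> by \<open>m\<close>: for fixed \<open>r\<close>, the
  time may depend on the dimensions alone.\<close>

definition time_bound :: "nat \<Rightarrow> nat \<Rightarrow> nat \<Rightarrow> nat" where
  "time_bound r m n = (5 * (m + n) + 6) + (7 * m + 7) + (m * (4 * (m + n) + 9) + 7) +
     (4 * n + 7 + (m + n) * (n * (4 * (r + m) + 8) + 6)) +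
     (n * (n * (8 * m + 13) + 10 * m + 23) + 3) + 4"

lemma runs_rounding:
  assumes inp: "holds_input m n a b c s" and B_def: "B = min (m + n) (nat \<lfloor>b\<rfloor>)"
    and init: "nmem s ''u'' = (\<lambda>_. 0)" "nmem s ''f'' = (\<lambda>_. 0)" "rmem s ''y'' 0 = (\<lambda>_. 0)"
  shows "runs (rounding_com r) s (time_bound r m n) (\<lambda>s'. \<exists>L \<sigma> u F.
    m \<le> 2 ^ L \<and> L \<le> m \<and> (L > 0 \<longrightarrow> 2 ^ (L - 1) < m) \<and>
    (B > 0 \<longrightarrow> L \<le> 2 ^ (\<sigma> * B)) \<and> (\<sigma> > 0 \<longrightarrow> 2 ^ ((\<sigma> - 1) * B) < L) \<and>
    greedy (2 ^ (r + \<sigma>)) B (pos_rows m a) c n u {..<n} F \<and> rmem s' ''y'' 0 = (\<lambda>j. of_bool (j \<in> F)))"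
    (is "runs _ _ _ ?Q")
proof -
  let ?t1 = "5 * (m + n) + 6" and ?t2 = "7 * m + 7" and ?t3 = "m * (4 * (m + n) + 9) + 7"
    and ?t4 = "4 * n + 7 + (m + n) * (n * (4 * (r + m) + 8) + 6)"
    and ?t5 = "n * (n * (8 * m + 13) + 10 * m + 23) + 3"
  show ?thesis unfolding rounding_com_def
  proof (rule runs_Seq[where M = ?t1 and N = "?t2 + ?t3 + ?t4 + ?t5 + 3"],
      rule runs_weaken[OF runs_capacity[OF inp] order_refl], rule impI)
    fix s1 :: state assume B1: "nmem s1 ''B'' 0 = min (m + n) (nat \<lfloor>b\<rfloor>)"
      and ag1: "agree (writes capacity_com) s s1"
    have inp1: "holds_input m n a b c s1" using holds_input_agree[OF ag1 inp] by simp
    show "runs (Seq log_com (Seq (base_com r) (Seq table_com greedy_com))) s1 (?t2 + ?t3 + ?t4 + ?t5 + 3) ?Q"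
    proof (rule runs_Seq[where M = ?t2 and N = "?t3 + ?t4 + ?t5 + 2"],
        rule runs_weaken[OF runs_log[OF inp1] order_refl], rule impI)
      fix s2 :: state assume log: "let L = nmem s2 ''L'' 0 in
          m \<le> 2 ^ L \<and> L \<le> m \<and> (L > 0 \<longrightarrow> 2 ^ (L - 1) < m)"
        and ag2: "agree (writes log_com) s1 s2"
      define L where "L = nmem s2 ''L'' 0"
      have L: "m \<le> 2 ^ L" "L \<le> m" "L > 0 \<longrightarrow> 2 ^ (L - 1) < m" using log by (simp_all add: Let_def L_def)
      have inp2: "holds_input m n a b c s2" using holds_input_agree[OF ag2 inp1] by simp
      have B2: "nmem s2 ''B'' 0 = B" using agree_nmem[OF ag2, of "''B''"] B1 B_def by simp
      have t3: "m * (4 * B + 9) + 7 \<le> ?t3"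
        by (intro add_le_mono mult_le_mono) (auto simp: B_def)
      show "runs (Seq (base_com r) (Seq table_com greedy_com)) s2 (?t3 + ?t4 + ?t5 + 2) ?Q"
      proof (rule runs_Seq[where M = ?t3 and N = "?t4 + ?t5 + 1"],
          rule runs_weaken[OF runs_base[OF inp2 B2 L_def[symmetric] L(2)] t3], rule impI, elim exE conjE)
        fix s3 :: state and \<sigma> assume g3: "nmem s3 ''g'' 0 = r + \<sigma>" and \<sigma>: "\<sigma> \<le> m"
          "B > 0 \<longrightarrow> L \<le> 2 ^ (\<sigma> * B)" "\<sigma> > 0 \<longrightarrow> 2 ^ ((\<sigma> - 1) * B) < L"
          and ag3: "agree (writes (base_com r)) s2 s3"
        have inp3: "holds_input m n a b c s3" using holds_input_agree[OF ag3 inp2] by simp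
        have B3: "nmem s3 ''B'' 0 = B" using agree_nmem[OF ag3, of "''B''"] B2 by simp
        have "B * (n * (4 * (r + \<sigma>) + 8) + 6) \<le> (m + n) * (n * (4 * (r + m) + 8) + 6)"
          using \<sigma>(1) by (intro mult_le_mono add_le_mono) (auto simp: B_def)
        then have t4: "4 * n + 3 + (B * (n * (4 * (r + \<sigma>) + 8) + 6) + 3) + 1 \<le> ?t4" by simp
        show "runs (Seq table_com greedy_com) s3 (?t4 + ?t5 + 1) ?Q"
        proof (rule runs_Seq[where M = ?t4 and N = ?t5],
            rule runs_weaken[OF runs_table[OF inp3 B3 g3] t4], rule impI)
          fix s4 :: state
          assume q: "\<forall>u\<le>B. \<forall>j<n. rmem s4 ''q'' u j = (2 ^ (r + \<sigma>)) ^ u * c j"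
            and ag4: "agree (writes table_com) s3 s4"
          have inp4: "holds_input m n a b c s4" using holds_input_agree[OF ag4 inp3] by simp
          have B4: "nmem s4 ''B'' 0 = B" using agree_nmem[OF ag4, of "''B''"] B3 by simp
          have init4: "nmem s4 ''u'' = (\<lambda>_. 0)" "nmem s4 ''f'' = (\<lambda>_. 0)" "rmem s4 ''y'' 0 = (\<lambda>_. 0)"
            using agree_nmem[OF ag1, of "''u''"] agree_nmem[OF ag1, of "''f''"] agree_rmem[OF ag1, of "''y''"]
              agree_nmem[OF ag2, of "''u''"] agree_nmem[OF ag2, of "''f''"] agree_rmem[OF ag2, of "''y''"]
              agree_nmem[OF ag3, of "''u''"] agree_nmem[OF ag3, of "''f''"] agree_rmem[OF ag3, of "''y''"]
              agree_nmem[OF ag4, of "''u''"] agree_nmem[OF ag4, of "''f''"] agree_rmem[OF ag4, of "''y''"]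
              init by simp_all
          show "runs greedy_com s4 ?t5 ?Q"
          proof (rule runs_weaken[OF runs_greedy[OF inp4 q B4 _ init4] order_refl], simp, elim exE conjE)
            fix s5 :: state and u F
            assume g: "greedy (2 ^ (r + \<sigma>)) B (pos_rows m a) c n u {..<n} F"
              and y: "rmem s5 ''y'' 0 = (\<lambda>j. of_bool (j \<in> F))"
            show "?Q s5"
              by (intro exI[of _ L] exI[of _ \<sigma>] exI[of _ u] exI[of _ F] conjI) (fact L \<sigma> g y)+
          qed
        qed simp
      qed simp
    qed simp
  qed (simp add: time_bound_def)
qed

section \<open>Closure of polynomial bounds under sums and products\<close>

lemma polynomially_bounded_const: "polynomially_bounded (\<lambda>m n. a)"
  unfolding polynomially_bounded_def by (intro exI[of _ a] exI[of _ 0]) simp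

lemma polynomially_bounded_fst: "polynomially_bounded (\<lambda>m n. m)"
  and polynomially_bounded_snd: "polynomially_bounded (\<lambda>m n. n)"
  unfolding polynomially_bounded_def by (intro exI[of _ 1]; simp)+

lemma polynomially_bounded_mult:
  assumes "polynomially_bounded f" "polynomially_bounded g"
  shows "polynomially_bounded (\<lambda>m n. f m n * g m n)"
proof -
  obtain C d C' d' where "\<And>m n. f m n \<le> C * (m + n + 1) ^ d" "\<And>m n. g m n \<le> C' * (m + n + 1) ^ d'"
    using assms unfolding polynomially_bounded_def by blast
  then have "f m n * g m n \<le> (C * C') * (m + n + 1) ^ (d + d')" for m n
    using mult_le_mono[of "f m n" "C * (m + n + 1) ^ d" "g m n" "C' * (m + n + 1) ^ d'"]
    by (simp add: power_add mult_ac)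
  then show ?thesis unfolding polynomially_bounded_def by blast
qed

lemma polynomially_bounded_add:
  assumes "polynomially_bounded f" "polynomially_bounded g"
  shows "polynomially_bounded (\<lambda>m n. f m n + g m n)"
proof -
  obtain C d C' d' where fg: "\<And>m n. f m n \<le> C * (m + n + 1) ^ d" "\<And>m n. g m n \<le> C' * (m + n + 1) ^ d'"
    using assms unfolding polynomially_bounded_def by blast
  have "f m n + g m n \<le> (C + C') * (m + n + 1) ^ (d + d')" for m n
  proof -
    have "f m n + g m n \<le> C * (m + n + 1) ^ d + C' * (m + n + 1) ^ d'"
      by (intro add_le_mono fg)
    also have "\<dots> \<le> C * (m + n + 1) ^ (d + d') + C' * (m + n + 1) ^ (d + d')"
      by (intro add_le_mono mult_le_mono2 power_increasing) auto
    finally show ?thesis by (simp add: distrib_right)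
  qed
  then show ?thesis unfolding polynomially_bounded_def by blast
qed

lemma polynomially_bounded_time_bound: "polynomially_bounded (time_bound r)"
proof -
  have "polynomially_bounded (\<lambda>m n. time_bound r m n)" unfolding time_bound_def
    by (intro polynomially_bounded_add polynomially_bounded_mult polynomially_bounded_const
        polynomially_bounded_fst polynomially_bounded_snd)
  then show ?thesis by simp
qed

section \<open>Column degrees of the random matrix\<close>

lemma pmf_prob_Compl: "measure_pmf.prob M (- A) = 1 - measure_pmf.prob M A"
  using measure_pmf.prob_compl[of A M] by (simp add: Compl_eq_Diff_UNIV)

lemma pmf_markov:
  fixes f :: "'a \<Rightarrow> real"
  assumes "finite (set_pmf M)" "\<And>x. f x \<ge> 0" "t > 0"
  shows "measure_pmf.prob M {x. f x \<ge> t} \<le> measure_pmf.expectation M f / t"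
  using integral_Markov_inequality_measure[of "measure_pmf M" f "{}" t] assms
  by (simp add: integrable_measure_pmf_finite)

section \<open>Avoidance probabilities within one row\<close>

lemma row_avoid:
  assumes "k \<le> n" "J \<subseteq> {..<n}"
  shows "measure_pmf.prob (row_pmf n k) {S. S \<inter> J = {}} = ((n - card J) choose k) / (n choose k)"
proof -
  let ?K = "{S. S \<subseteq> {..<n} \<and> card S = k}"
  have fin: "finite ?K" by (rule finite_subset[of _ "Pow {..<n}"]) auto
  have card: "card ?K = n choose k" using n_subsets[of "{..<n}" k] by simp
  then have ne: "?K \<noteq> {}" using assms(1) by (metis card.empty zero_less_binomial less_irrefl)
  have "?K \<inter> {S. S \<inter> J = {}} = {S. S \<subseteq> {..<n} - J \<and> card S = k}" by auto
  then have "card (?K \<inter> {S. S \<inter> J = {}}) = (n - card J) choose k"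
    using n_subsets[of "{..<n} - J" k] assms by (simp add: card_Diff_subset finite_subset[OF assms(2)])
  then show ?thesis unfolding row_pmf_def using measure_pmf_of_set[OF ne fin] card by simp
qed

lemma row_avoid_one:
  assumes "k \<le> n" "j < n"
  shows "measure_pmf.prob (row_pmf n k) {S. S \<inter> {j} = {}} = 1 - k / n"
proof -
  have "(n - k) * (n choose k) = n * ((n - 1) choose k)" by (rule binomial_absorb_comp)
  then have "(real n - real k) * (n choose k) = real n * ((n - 1) choose k)"
    using assms by (metis of_nat_diff of_nat_mult)
  moreover have "real (n choose k) > 0" using assms by simp
  ultimately have "((n - 1) choose k) / (n choose k) = 1 - k / n"
    using assms by (simp add: field_simps)
  then show ?thesis using row_avoid[of k n "{j}"] assms by simp
qed

text \<open>The ones of a row are drawn without replacement, which makes avoiding two columns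
  negatively correlated: the exact probability is (n - k) / n * ((n - 1 - k) / (n - 1)). In the case
  k = n, natural subtraction would truncate n - 1 - k, so it is treated separately.\<close>

lemma row_avoid_two:
  assumes "k \<le> n" "j < n" "l < n" "j \<noteq> l"
  shows "measure_pmf.prob (row_pmf n k) {S. S \<inter> {j, l} = {}} \<le> (1 - k / n)\<^sup>2"
proof (cases "k = n")
  case True
  then show ?thesis using row_avoid[of k n "{j, l}"] assms by simp
next
  case False
  then have k: "k \<le> n - 1" and n: "n \<ge> 2" using assms by auto
  have "(n - k) * (n choose k) = n * ((n - 1) choose k)" by (rule binomial_absorb_comp)
  then have 1: "(real n - real k) * (n choose k) = real n * ((n - 1) choose k)"
    using assms by (metis of_nat_diff of_nat_mult)
  have "(n - 1 - k) * ((n - 1) choose k) = (n - 1) * ((n - 1 - 1) choose k)" by (rule binomial_absorb_comp)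
  then have "real (n - 1 - k) * ((n - 1) choose k) = real (n - 1) * ((n - 2) choose k)"
    by (metis of_nat_mult diff_diff_left one_add_one)
  then have 2: "(real n - 1 - real k) * ((n - 1) choose k) = (real n - 1) * ((n - 2) choose k)"
    using k n by (simp add: of_nat_diff diff_diff_eq)
  have pos: "real (n choose k) > 0" using assms by simp
  have "((n - 2) choose k) = (real n - 1 - k) / (real n - 1) * ((n - 1) choose k)"
    using 2 n by (simp add: field_simps)
  also have "real ((n - 1) choose k) = (real n - k) / n * (n choose k)"
    using 1 n by (simp add: field_simps)
  finally have "((n - 2) choose k) / (n choose k) = (real n - 1 - k) / (real n - 1) * ((real n - k) / n)"
    using pos by simp
  also have "\<dots> \<le> (1 - k / n) * (1 - k / n)"
  proof (intro mult_mono)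
    show "(real n - 1 - k) / (real n - 1) \<le> 1 - k / n" "(real n - k) / n \<le> 1 - k / n"
      using n by (auto simp: field_simps)
  qed (use assms in auto)
  finally show ?thesis using row_avoid[of k n "{j, l}"] assms by (simp add: power2_eq_square numeral_2_eq_2)
qed

section \<open>Column degrees over independent rows\<close>

definition supports_pmf :: "nat \<Rightarrow> nat \<Rightarrow> nat \<Rightarrow> (nat \<Rightarrow> nat set) pmf" where
  "supports_pmf m n k = Pi_pmf {..<m} {} (\<lambda>_. row_pmf n k)"

lemma finite_set_row_pmf: "k \<le> n \<Longrightarrow> finite (set_pmf (row_pmf n k))"
proof -
  assume "k \<le> n"
  then have "{S. S \<subseteq> {..<n} \<and> card S = k} \<noteq> {}"
    using n_subsets[of "{..<n}" k] by (metis card.empty finite_lessThan card_lessThan zero_less_binomial less_irrefl)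
  moreover have "finite {S. S \<subseteq> {..<n} \<and> card S = k}"
    by (rule finite_subset[of _ "Pow {..<n}"]) auto
  ultimately show ?thesis by (simp add: row_pmf_def)
qed

lemma finite_set_supports_pmf: "k \<le> n \<Longrightarrow> finite (set_pmf (supports_pmf m n k))"
  unfolding supports_pmf_def using finite_set_row_pmf by (subst set_Pi_pmf) auto

definition column_of :: "nat \<Rightarrow> (nat \<Rightarrow> nat set) \<Rightarrow> nat \<Rightarrow> nat set" where
  "column_of m S j = {i. i < m \<and> j \<in> S i}"

lemma column_of_empty_iff: "column_of m S j = {} \<longleftrightarrow> (\<forall>i<m. S i \<inter> {j} = {})"
  by (auto simp: column_of_def)

lemma prob_avoid:
  "measure_pmf.prob (supports_pmf m n k) {S. \<forall>i<m. S i \<inter> J = {}} =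
    measure_pmf.prob (row_pmf n k) {S. S \<inter> J = {}} ^ m"
proof -
  have "{S. \<forall>i<m. S i \<inter> J = {}} = Pi {..<m} (\<lambda>_. {S. S \<inter> J = {}})" by auto
  then show ?thesis by (simp add: supports_pmf_def measure_Pi_pmf_Pi)
qed

lemma prob_empty_column:
  assumes "k \<le> n" "j < n"
  shows "measure_pmf.prob (supports_pmf m n k) {S. column_of m S j = {}} = (1 - k / n) ^ m"
  using prob_avoid[of m n k "{j}"] row_avoid_one[OF assms] by (simp add: column_of_empty_iff)

lemma prob_two_empty_columns:
  assumes "k \<le> n" "j < n" "l < n" "j \<noteq> l"
  shows "measure_pmf.prob (supports_pmf m n k) {S. column_of m S j = {} \<and> column_of m S l = {}}
    \<le> ((1 - k / n) ^ m)\<^sup>2"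
proof -
  have "{S. column_of m S j = {} \<and> column_of m S l = {}} = {S. \<forall>i<m. S i \<inter> {j, l} = {}}"
    by (auto simp: column_of_def)
  then have "measure_pmf.prob (supports_pmf m n k) {S. column_of m S j = {} \<and> column_of m S l = {}} =
      measure_pmf.prob (row_pmf n k) {S. S \<inter> {j, l} = {}} ^ m"
    by (simp only: prob_avoid)
  also have "\<dots> \<le> ((1 - k / n)\<^sup>2) ^ m" by (intro power_mono row_avoid_two assms) auto
  finally show ?thesis by (simp add: power_mult[symmetric] mult.commute)
qed

text \<open>The generating function of the degree factorizes over the independent rows, each of
  which contributes 1 * (1 - k / n) + 2 * (k / n).\<close>

lemma expectation_two_power_degree:
  assumes "k \<le> n" "j < n"
  shows "measure_pmf.expectation (supports_pmf m n k) (\<lambda>S. 2 ^ card (column_of m S j)) = (1 + k / n) ^ m"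
proof -
  let ?f = "\<lambda>T. if j \<in> T then 2 else 1 :: real"
  have int: "integrable (measure_pmf (row_pmf n k)) f" for f :: "nat set \<Rightarrow> real"
    using assms by (intro integrable_measure_pmf_finite finite_set_row_pmf)
  have "(2::real) ^ card (column_of m S j) = (\<Prod>i<m. ?f (S i))" for S
  proof -
    have "(\<Prod>i<m. ?f (S i)) = (\<Prod>i\<in>column_of m S j. 2)"
      by (simp add: prod.If_cases column_of_def Int_def)
    then show ?thesis by simp
  qed
  then have "measure_pmf.expectation (supports_pmf m n k) (\<lambda>S. 2 ^ card (column_of m S j)) =
      measure_pmf.expectation (supports_pmf m n k) (\<lambda>S. \<Prod>i<m. ?f (S i))" by simp
  also have "\<dots> = (\<Prod>i<m. measure_pmf.expectation (row_pmf n k) ?f)"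
    unfolding supports_pmf_def by (intro expectation_prod_Pi_pmf int) auto
  also have "measure_pmf.expectation (row_pmf n k) ?f =
      measure_pmf.expectation (row_pmf n k) (\<lambda>T. 2 - indicator {S. S \<inter> {j} = {}} T)"
    by (intro arg_cong[where f = "measure_pmf.expectation (row_pmf n k)"]) (auto simp: indicator_def)
  also have "\<dots> = 2 - measure_pmf.prob (row_pmf n k) {S. S \<inter> {j} = {}}"
    by (subst Bochner_Integration.integral_diff) (auto intro: int simp del: Int_insert_right)
  also have "\<dots> = 1 + k / n" using row_avoid_one[OF assms] by simp
  finally show ?thesis by simp
qed

text \<open>Markov's inequality for 2 ^ d, where d is the degree. By \<open>mn\<close>, the average
  degree m * k / n is at most log 2 m; so the expectation is at most exp (log 2 m), and log 2 m
  \<le> 2 * ln m bounds it by m ^ 2.\<close>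

lemma prob_high_degree:
  assumes "k \<le> n" "j < n" "2 \<le> m" and mn: "real m \<le> real n * log 2 (real m) / real k" and "1 \<le> k"
  shows "measure_pmf.prob (supports_pmf m n k) {S. C * log 2 m < card (column_of m S j)} \<le> m powr (2 - C)"
proof -
  let ?M = "supports_pmf m n k"
  have n: "real n > 0" "real k > 0" using assms by auto
  have "measure_pmf.prob ?M {S. C * log 2 m < card (column_of m S j)} \<le>
      measure_pmf.prob ?M {S. 2 ^ card (column_of m S j) \<ge> m powr C}"
  proof (intro measure_pmf.finite_measure_mono subsetI CollectI)
    fix S assume "S \<in> {S. C * log 2 m < card (column_of m S j)}"
    then have "2 powr (C * log 2 m) \<le> 2 powr card (column_of m S j)" by simp
    moreover have "2 powr (C * log 2 m) = m powr C"
      using assms by (simp add: mult.commute[of C] powr_powr[symmetric])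
    ultimately show "m powr C \<le> 2 ^ card (column_of m S j)" by (simp add: powr_realpow)
  qed auto
  also have "\<dots> \<le> measure_pmf.expectation ?M (\<lambda>S. 2 ^ card (column_of m S j)) / m powr C"
    using assms by (intro pmf_markov finite_set_supports_pmf) auto
  also have "\<dots> = (1 + k / n) ^ m / m powr C" using expectation_two_power_degree assms by simp
  also have "(1 + k / n) ^ m \<le> exp (k / n) ^ m" by (intro power_mono exp_ge_add_one_self) auto
  also have "\<dots> = exp (m * (k / n))" by (rule exp_of_nat_mult[symmetric])
  also have "m * (k / n) \<le> log 2 m" using mn n by (simp add: field_simps)
  also have "log 2 m \<le> 2 * ln m"
  proof -
    have "ln m * 1 \<le> ln m * (2 * ln 2)" using ln2_ge_two_thirds assms by (intro mult_left_mono) auto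
    then show ?thesis by (simp add: log_def field_simps)
  qed
  also have "exp (2 * ln m) = m powr 2" using assms by (simp add: powr_def)
  finally show ?thesis using assms by (simp add: powr_diff divide_right_mono)
qed

text \<open>For 0 \<le> z \<le> 2 / 3 one has (1 - z) * (1 + 3 * z) = 1 + z * (2 - 3 * z) \<ge> 1,
  hence 1 - z \<ge> exp (- 3 * z). At z = k / n, the power \<open>m\<close> of this is at least exp
  (- 3 * log 2 m), and 3 / ln 2 \<le> 5 explains the exponent.\<close>

lemma empty_column_lower:
  assumes "k \<le> n" "2 \<le> m" and mn: "real m \<le> real n * log 2 (real m) / real k" and "1 \<le> k"
  shows "(1 - k / n) ^ m \<ge> m powr (-5)"
proof -
  let ?q = "real k / real n"
  have n: "real n > 0" "real k > 0" using assms by auto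
  have mq: "m * ?q \<le> log 2 m" using mn n by (simp add: field_simps)
  \<comment> \<open>In logarithms, 3 * log 2 m \<le> 2 * m; this turns m * (k / n) \<le> log 2 m
    into k / n \<le> 2 / 3.\<close>
  have "m ^ 3 \<le> (4::nat) ^ m" using assms(2)
  proof (induction m rule: nat_induct_at_least)
    case (Suc m)
    have "m * m * 2 \<le> m * m * m" "m * 4 \<le> m * m * 2" using Suc by (auto simp: mult_mono)
    moreover have "m * 2 \<le> m * m" "2 \<le> m" using Suc by auto
    moreover have "Suc m ^ 3 = m * m * m + 3 * (m * m) + 3 * m + 1" by (simp add: power3_eq_cube algebra_simps)
    moreover have "m * m * m \<le> 4 ^ m" using Suc by (simp add: power3_eq_cube mult.assoc)
    moreover have "4 ^ Suc m = 4 * (4 ^ m :: nat)" by simp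
    ultimately show ?case by linarith
  qed simp
  then have "real m ^ 3 \<le> 4 ^ m" by (metis of_nat_le_iff of_nat_numeral of_nat_power)
  then have "log 2 (real m ^ 3) \<le> log 2 (4 ^ m)" using assms by (subst log_le_cancel_iff) auto
  then have "3 * log 2 m \<le> 2 * real m" using assms log_pow_cancel[of 2 2] by (simp add: log_nat_power)
  moreover have "3 * (m * ?q) \<le> 3 * log 2 m" using mq by (rule mult_left_mono) simp
  ultimately have "3 * (m * ?q) \<le> 2 * real m" by (rule order_trans[rotated])
  moreover have "m * (3 * ?q) = 3 * (m * ?q)" by simp
  ultimately have "m * (3 * ?q) \<le> real m * 2" by (metis mult.commute of_nat_mult of_nat_numeral)
  then have q: "3 * ?q \<le> 2" by (rule mult_left_le_imp_le) (use assms in simp)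
  have "exp (- 3 * ?q) \<le> 1 - ?q"
  proof -
    have "1 \<le> (1 - z) * (1 + 3 * z)" if "0 \<le> z" "3 * z \<le> 2" for z :: real
    proof -
      have "z * (2 - 3 * z) \<ge> 0" using that by (intro mult_nonneg_nonneg) auto
      then show ?thesis by (simp add: algebra_simps)
    qed
    from this[of ?q] have "1 \<le> (1 - ?q) * (1 + 3 * ?q)" using q by simp
    also have "\<dots> \<le> (1 - ?q) * exp (3 * ?q)" using q by (intro mult_left_mono exp_ge_add_one_self) auto
    finally show ?thesis by (simp add: exp_minus field_simps)
  qed
  have "ln m * 3 \<le> ln m * (5 * ln 2)" using ln2_ge_two_thirds assms by (intro mult_left_mono) auto
  then have "3 * log 2 m \<le> 5 * ln m" by (simp add: log_def field_simps)
  have "m powr (-5) = exp (- 5 * ln m)" using assms by (simp add: powr_def)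
  also have "\<dots> \<le> exp (- 3 * (m * ?q))" using mq \<open>3 * log 2 m \<le> 5 * ln m\<close> by simp
  also have "\<dots> = exp (- 3 * ?q) ^ m" by (simp add: exp_of_nat_mult[symmetric] mult_ac)
  also have "\<dots> \<le> (1 - ?q) ^ m" using \<open>exp (- 3 * ?q) \<le> 1 - ?q\<close> by (intro power_mono) auto
  finally show ?thesis .
qed

text \<open>If the total weight is polynomial in \<open>m\<close>, then the columns of high degree have small total
  weight, by Markov's inequality. Otherwise, the weight of the blank columns concentrates around
  its mean, by Chebyshev's inequality, and exceeds the weight of the columns of high degree.\<close>

lemma prob_heavy_columns:
  fixes c :: "nat \<Rightarrow> real" and \<gamma> :: real
  assumes k: "1 \<le> k" "k \<le> n" and m: "2 \<le> m" and mn: "real m \<le> real n * log 2 (real m) / real k"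
    and c: "\<And>j. j < n \<Longrightarrow> 0 < c j \<and> c j \<le> 1" and \<gamma>: "\<gamma> > 0" and C: "C = 10 + 2 * \<gamma>"
  defines "heavy \<equiv> \<lambda>S. \<Sum>j | j < n \<and> C * log 2 m < card (column_of m S j). c j"
    and "blank \<equiv> \<lambda>S. \<Sum>j | j < n \<and> column_of m S j = {}. c j"
  shows "measure_pmf.prob (supports_pmf m n k) {S. heavy S < 1 \<or> heavy S \<le> blank S} \<ge> 1 - m powr (-\<gamma>)"
proof -
  let ?M = "supports_pmf m n k"
  let ?E = "measure_pmf.expectation ?M" and ?P = "measure_pmf.prob ?M"
  define W where "W = (\<Sum>j<n. c j)"
  define \<pi> where "\<pi> = (1 - k / n) ^ m"
  have int: "integrable ?M f" for f :: "_ \<Rightarrow> real"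
    using k by (intro integrable_measure_pmf_finite finite_set_supports_pmf)
  note fin = finite_set_supports_pmf[OF k(2), of m]
  have n: "n > 0" using k by simp
  have W: "W > 0" unfolding W_def using c n by (intro sum_pos) auto
  have \<pi>: "\<pi> \<ge> m powr (-5)" unfolding \<pi>_def using empty_column_lower[OF k(2) m mn k(1)] .
  then have \<pi>0: "\<pi> > 0" using m by (intro less_le_trans[OF _ \<pi>]) auto
  have indic: "(\<Sum>j | j < n \<and> Q j. c j) = (\<Sum>j<n. c j * of_bool (Q j))" for Q
    by (simp add: sum.If_cases Int_def of_bool_def if_distrib[of "(*) _"] cong: if_cong)
  have E_bool: "?E (\<lambda>S. of_bool (Q S)) = ?P {S. Q S}" for Q
  proof -
    have "?E (\<lambda>S. of_bool (Q S)) = ?E (indicator {S. Q S})"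
      by (intro arg_cong[where f = ?E]) (auto simp: indicator_def)
    also have "\<dots> = ?P {S. Q S}" by (simp add: measure_pmf.emeasure_eq_measure)
    finally show ?thesis .
  qed
  have heavy0: "heavy S \<ge> 0" for S
    unfolding heavy_def using c by (intro sum_nonneg) (auto intro: less_imp_le)
  have "?E heavy = (\<Sum>j<n. c j * ?P {S. C * log 2 m < card (column_of m S j)})"
    unfolding heavy_def indic by (subst Bochner_Integration.integral_sum) (auto intro: int simp: E_bool)
  also have "\<dots> \<le> (\<Sum>j<n. c j * m powr (2 - C))"
    using c prob_high_degree[OF k(2) _ m mn k(1)] by (intro sum_mono mult_left_mono) (auto intro: less_imp_le)
  finally have Eheavy: "?E heavy \<le> m powr (2 - C) * W"
    by (simp add: W_def sum_distrib_right mult.commute)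
  show ?thesis
  \<comment> \<open>The largest total weight that Markov's inequality can handle alone: (2 - C) + (8
    + \<gamma>) = - \<gamma>.\<close>
  proof (cases "W \<le> m powr (8 + \<gamma>)")
    case True
    have "?P {S. heavy S \<ge> 1} \<le> ?E heavy / 1"
      using heavy0 by (intro pmf_markov fin) auto
    also have "\<dots> \<le> m powr (2 - C) * m powr (8 + \<gamma>)"
      using Eheavy mult_left_mono[OF True, of "m powr (2 - C)"] by simp
    also have "\<dots> = m powr (-\<gamma>)" by (simp add: C flip: powr_add)
    finally have "?P (- {S. heavy S \<ge> 1}) \<ge> 1 - m powr (-\<gamma>)"
      unfolding pmf_prob_Compl by simp
    also have "?P (- {S. heavy S \<ge> 1}) \<le> ?P {S. heavy S < 1 \<or> heavy S \<le> blank S}"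
      by (intro measure_pmf.finite_measure_mono) auto
    finally show ?thesis .
  next
    case False
    define V where "V S = (blank S - \<pi> * W)\<^sup>2" for S
    have "?E blank = (\<Sum>j<n. c j * ?P {S. column_of m S j = {}})"
      unfolding blank_def indic by (subst Bochner_Integration.integral_sum) (auto intro: int simp: E_bool)
    also have "\<dots> = \<pi> * W"
      using prob_empty_column[OF k(2)] by (simp add: \<pi>_def W_def sum_distrib_right mult.commute)
    finally have E1: "?E blank = \<pi> * W" .
    have blank: "blank S = (\<Sum>j<n. c j * of_bool (column_of m S j = {}))" for S
      unfolding blank_def by (rule indic)
    \<comment> \<open>The second moment: two distinct columns are both empty with probability at
      most \<pi> ^ 2, and the diagonal adds at most \<pi> * W because c j * c j \<le> c j. So the
      variance is at most the mean \<pi> * W.\<close>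
    have "?E (\<lambda>S. (blank S)\<^sup>2) = ?E (\<lambda>S. \<Sum>j<n. \<Sum>l<n. c j * c l *
        of_bool (column_of m S j = {} \<and> column_of m S l = {}))"
      unfolding blank power2_eq_square sum_product by (simp add: of_bool_conj mult_ac)
    also have "\<dots> = (\<Sum>j<n. \<Sum>l<n. c j * c l * ?P {S. column_of m S j = {} \<and> column_of m S l = {}})"
      by (subst Bochner_Integration.integral_sum, rule int, intro sum.cong refl,
          subst Bochner_Integration.integral_sum) (auto intro: int simp: E_bool simp del: of_bool_conj)
    also have "\<dots> \<le> (\<Sum>j<n. \<Sum>l<n. c j * c l * (\<pi>\<^sup>2 + of_bool (j = l) * \<pi>))"
    proof (intro sum_mono mult_left_mono)
      fix j l assume jl: "j \<in> {..<n}" "l \<in> {..<n}"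
      show "?P {S. column_of m S j = {} \<and> column_of m S l = {}} \<le> \<pi>\<^sup>2 + of_bool (j = l) * \<pi>"
        using prob_empty_column[OF k(2), of j m] prob_two_empty_columns[OF k(2), of j l m] jl
        by (cases "j = l") (auto simp: \<pi>_def)
    qed (use c in \<open>auto intro!: mult_nonneg_nonneg intro: less_imp_le\<close>)
    also have "\<dots> = \<pi>\<^sup>2 * W\<^sup>2 + \<pi> * (\<Sum>j<n. c j * c j)"
    proof -
      have "(\<Sum>l<n. c j * c l * (of_bool (j = l) * \<pi>)) = \<pi> * (c j * c j)" if "j < n" for j
      proof -
        have "(\<Sum>l<n. c j * c l * (of_bool (j = l) * \<pi>)) = (\<Sum>l\<in>{j}. c j * c l * (of_bool (j = l) * \<pi>))"
          using that by (intro sum.mono_neutral_right) auto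
        then show ?thesis by simp
      qed
      then show ?thesis
        by (simp add: distrib_left sum.distrib W_def power2_eq_square sum_product sum_distrib_left
            sum_distrib_right mult_ac)
    qed
    also have "(\<Sum>j<n. c j * c j) \<le> W"
      unfolding W_def using c by (intro sum_mono mult_left_le) (auto intro: less_imp_le)
    finally have E2: "?E (\<lambda>S. (blank S)\<^sup>2) \<le> \<pi>\<^sup>2 * W\<^sup>2 + \<pi> * W" using \<pi>0 by simp
    have "?E V = ?E (\<lambda>S. (blank S)\<^sup>2 - 2 * (\<pi> * W) * blank S + (\<pi> * W)\<^sup>2)"
      unfolding V_def by (simp add: power2_diff algebra_simps)
    also have "\<dots> = ?E (\<lambda>S. (blank S)\<^sup>2) - 2 * (\<pi> * W) * ?E blank + (\<pi> * W)\<^sup>2"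
      by (simp add: int Bochner_Integration.integral_add Bochner_Integration.integral_diff)
    also have "\<dots> \<le> \<pi> * W" using E2 by (simp add: E1 power2_eq_square algebra_simps)
    finally have EV: "?E V \<le> \<pi> * W" .
    have \<pi>W: "\<pi> * W > 0" using \<pi>0 W by simp
    \<comment> \<open>Here the bound m powr (- 5) on the probability of an empty column is spent: 8
      + \<gamma> - 5 = 3 + \<gamma>.\<close>
    have \<pi>W_ge: "m powr (3 + \<gamma>) \<le> \<pi> * W"
    proof -
      have "m powr (-5) * m powr (8 + \<gamma>) \<le> \<pi> * W" using \<pi> False \<pi>0 by (intro mult_mono) auto
      then show ?thesis by (simp flip: powr_add)
    qed
    have m2: "2 \<le> real m" "4 \<le> m powr 2"
      using m mult_mono[of 2 "real m" 2 "real m"] by (auto simp: power2_eq_square)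
    \<comment> \<open>Chebyshev's inequality at half the mean fails with probability at most 4 /
      (\<pi> * W), and m ^ 2 absorbs the 4.\<close>
    have "?P {S. V S \<ge> (\<pi> * W / 2)\<^sup>2} \<le> ?E V / (\<pi> * W / 2)\<^sup>2"
      using \<pi>W by (intro pmf_markov fin) (auto simp: V_def)
    also have "\<dots> \<le> \<pi> * W / (\<pi> * W / 2)\<^sup>2" using EV by (rule divide_right_mono) simp
    also have "\<dots> = 4 / (\<pi> * W)" using \<pi>W by (simp add: power2_eq_square field_simps)
    also have "\<dots> \<le> m powr 2 / m powr (3 + \<gamma>)"
      using \<pi>W_ge \<pi>W m2 m by (intro frac_le) auto
    also have "\<dots> = m powr (2 - (3 + \<gamma>))" by (rule powr_diff[symmetric])
    also have "2 - (3 + \<gamma>) = -\<gamma> - 1" by simp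
    finally have P1: "?P {S. V S \<ge> (\<pi> * W / 2)\<^sup>2} \<le> m powr (-\<gamma> - 1)" .
    \<comment> \<open>The weight \<open>W\<close> cancels: the mean of \<open>heavy\<close> is at
      most m powr (7 - C) times that of \<open>blank\<close>, however large \<open>W\<close> is.
      Halving the threshold costs another factor \<open>m\<close>.\<close>
    have "?P {S. heavy S \<ge> \<pi> * W / 2} \<le> ?E heavy / (\<pi> * W / 2)"
      using heavy0 \<pi>W by (intro pmf_markov fin) auto
    also have "\<dots> \<le> (m powr (2 - C) * W) / (\<pi> * W / 2)"
      using Eheavy \<pi>W by (intro divide_right_mono) auto
    also have "\<dots> = 2 * m powr (2 - C) / \<pi>" using W by (simp add: field_simps)
    also have "\<dots> \<le> real m * m powr (2 - C) / m powr (-5)"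
      using \<pi> m2 m by (intro frac_le mult_right_mono) auto
    also have "\<dots> = m powr 1 * m powr (2 - C) / m powr (-5)" using m by simp
    also have "\<dots> = m powr (1 + (2 - C) - (-5))" by (simp only: powr_add powr_diff)
    also have "1 + (2 - C) - (-5) = 8 - C" by simp
    also have "m powr (8 - C) \<le> m powr (-\<gamma> - 1)" using m \<gamma> by (intro powr_mono) (auto simp: C)
    finally have P2: "?P {S. heavy S \<ge> \<pi> * W / 2} \<le> m powr (-\<gamma> - 1)" .
    let ?bad = "{S. V S \<ge> (\<pi> * W / 2)\<^sup>2} \<union> {S. heavy S \<ge> \<pi> * W / 2}"
    have "?P ?bad \<le> 2 * m powr (-\<gamma> - 1)"
      using measure_Un_le[of "{S. V S \<ge> (\<pi> * W / 2)\<^sup>2}" ?M "{S. heavy S \<ge> \<pi> * W / 2}"]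
        P1 P2 by simp
    also have "\<dots> \<le> m powr 1 * m powr (-\<gamma> - 1)" using m by (intro mult_right_mono) auto
    also have "\<dots> = m powr (-\<gamma>)" by (subst powr_add[symmetric]) simp
    finally have "?P (- ?bad) \<ge> 1 - m powr (-\<gamma>)"
      unfolding pmf_prob_Compl by simp
    also have "?P (- ?bad) \<le> ?P {S. heavy S < 1 \<or> heavy S \<le> blank S}"
    proof (intro measure_pmf.finite_measure_mono subsetI CollectI disjI2)
      fix S assume S: "S \<in> - ?bad"
      then have "\<not> \<bar>\<pi> * W / 2\<bar> \<le> \<bar>blank S - \<pi> * W\<bar>"
        unfolding abs_le_square_iff by (simp add: V_def)
      moreover have "heavy S < \<pi> * W / 2" using S by auto
      ultimately show "heavy S \<le> blank S" using \<pi>W by linarith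
    qed auto
    finally show ?thesis .
  qed
qed

section \<open>Quality of the rounding\<close>

text \<open>The link between the machine and the abstract algorithm. Memory consists of total
  functions, so \<open>E\<close> and \<open>c'\<close> are cut off at the dimensions of the
  input.\<close>

lemma rounding_com_rounds:
  fixes A :: "real mat"
  assumes A: "A \<in> carrier_mat m n" and c: "c \<in> carrier_vec n"
    and B: "B = min (m + n) (nat \<lfloor>b\<rfloor>)"
  defines "E \<equiv> \<lambda>j. {i. i < m \<and> j < n \<and> 0 < A $$ (i, j)}"
    and "c' \<equiv> \<lambda>j. if j < n then c $ j else 0"
  shows "\<exists>t L \<sigma> u F. rounds (rounding_com r) A b c x w t (vec n (\<lambda>j. of_bool (j \<in> F))) \<and>
    t \<le> time_bound r m n \<and> m \<le> 2 ^ L \<and> L \<le> m \<and> (L > 0 \<longrightarrow> 2 ^ (L - 1) < m) \<and>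
    (B > 0 \<longrightarrow> L \<le> 2 ^ (\<sigma> * B)) \<and> (\<sigma> > 0 \<longrightarrow> 2 ^ ((\<sigma> - 1) * B) < L) \<and>
    greedy (2 ^ (r + \<sigma>)) B E c' n u {..<n} F"
proof -
  let ?s = "initial_state A b c x w"
  let ?a = "\<lambda>i j. if i < m \<and> j < n then A $$ (i, j) else 0"
  have dim: "dim_row A = m" "dim_col A = n" "dim_vec c = n" using A c by auto
  have inp: "holds_input m n ?a b c' ?s"
    unfolding holds_input_def initial_state_def c'_def dim by (simp add: fun_eq_iff)
  have E: "pos_rows m ?a = E" by (auto simp: pos_rows_def E_def fun_eq_iff)
  have "nmem ?s ''u'' = (\<lambda>_. 0)" "nmem ?s ''f'' = (\<lambda>_. 0)" "rmem ?s ''y'' 0 = (\<lambda>_. 0)"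
    by (simp_all add: initial_state_def fun_eq_iff)
  from runs_rounding[OF inp B this, of r] obtain t s' L \<sigma> u F where
    "exec (rounding_com r) ?s t s'" "t \<le> time_bound r m n" "m \<le> 2 ^ L" "L \<le> m"
    "L > 0 \<longrightarrow> 2 ^ (L - 1) < m" "B > 0 \<longrightarrow> L \<le> 2 ^ (\<sigma> * B)" "\<sigma> > 0 \<longrightarrow> 2 ^ ((\<sigma> - 1) * B) < L"
    "greedy (2 ^ (r + \<sigma>)) B E c' n u {..<n} F" "rmem s' ''y'' 0 = (\<lambda>j. of_bool (j \<in> F))"
    unfolding runs_def E by blast
  moreover from this have "rounds (rounding_com r) A b c x w t (vec n (\<lambda>j. of_bool (j \<in> F)))"
    unfolding rounds_def dim by (intro exI[of _ s']) simp
  ultimately show ?thesis by blast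
qed

lemma rounding_in_time_rounding_com: "rounding_in_time (rounding_com r) (time_bound r)"
  unfolding rounding_in_time_def
proof (intro allI impI)
  fix m n b w and A :: "real mat" and c x :: "real vec"
  assume "A \<in> carrier_mat m n" "c \<in> carrier_vec n"
  from rounding_com_rounds[OF this refl, where r = r and b = b and x = x and w = w] obtain t F where
    "rounds (rounding_com r) A b c x w t (vec n (\<lambda>j. of_bool (j \<in> F)))" "t \<le> time_bound r m n" by blast
  moreover have "set\<^sub>v (vec n (\<lambda>j. of_bool (j \<in> F))) \<subseteq> {0, 1 :: real}" by (auto simp: vec_set_def)
  ultimately show "\<exists>t y. rounds (rounding_com r) A b c x w t y \<and> t \<le> time_bound r m n \<and> set\<^sub>v y \<subseteq> {0, 1}"
    by blast
qed

text \<open>For \<sigma> \<ge> 2, minimality gives 2 ^ ((\<sigma> - 1) * B) < L \<le> 2 * log 2 m.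
  Taking roots, 2 ^ (\<sigma> - 1) \<le> 2 * (log 2 m) powr (1 / B), and 1 / B \<le> 2 / b trades
  the floor for the square of the logarithm. One factor 2 is that of \<open>L\<close>, the other
  undoes \<sigma> - 1.\<close>

lemma log_base_bound:
  fixes b :: real
  assumes m: "2 \<le> m" and b: "1 \<le> b" and B: "B = min (m + n) (nat \<lfloor>b\<rfloor>)" and "L \<le> m"
    and L: "L > 0 \<longrightarrow> 2 ^ (L - 1) < m" and \<sigma>: "\<sigma> > 0 \<longrightarrow> 2 ^ ((\<sigma> - 1) * B) < L"
  shows "2 ^ \<sigma> \<le> 4 * ((log 2 m)\<^sup>2) powr (1 / b)"
proof (cases "\<sigma> \<le> 1")
  case True
  have "log 2 m \<ge> 1" using m by simp
  then have "(log 2 m)\<^sup>2 powr (1 / b) \<ge> 1" using b by (intro ge_one_powr_ge_zero) auto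
  moreover have "(2::real) ^ \<sigma> \<le> 2 ^ 1" using True by (intro power_increasing) auto
  ultimately show ?thesis by simp
next
  case False
  define s where "s = \<sigma> - 1"
  have s: "s \<ge> 1" "\<sigma> = Suc s" and Ls: "2 ^ (s * B) < L" using False \<sigma> by (auto simp: s_def)
  \<comment> \<open>So the cap on the capacity is not active and \<open>B\<close> is the floor of
    \<open>b\<close>: a capacity of \<open>m\<close> would give 2 ^ (s * B) \<ge> 2 ^ m > L.\<close>
  have "B < m"
  proof (rule ccontr)
    assume "\<not> B < m"
    then have "m \<le> s * B" using mult_le_mono[of 1 s m B] s by simp
    then have "(2::nat) ^ m \<le> 2 ^ (s * B)" by (intro power_increasing) auto
    then show False using Ls \<open>L \<le> m\<close> less_exp[of m] by linarith
  qed
  then have Bb: "B = nat \<lfloor>b\<rfloor>" "B \<ge> 1" using B le_nat_floor[of 1 b] b by auto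
  then have b2: "b \<le> 2 * B" by linarith
  have \<ell>: "log 2 m \<ge> 1" using m by simp
  have L0: "L > 0" using Ls by simp
  then have "2 ^ (L - 1) < m" using L by simp
  then have "2 ^ (L - 1) < real m" by (metis of_nat_less_iff of_nat_numeral of_nat_power)
  then have "real (L - 1) < log 2 m" using m by (simp add: less_log_iff powr_realpow)
  then have L2: "real L \<le> 2 * log 2 m" using L0 \<ell> by (simp add: of_nat_diff)
  have "(2::real) ^ (s * B) < L" using Ls by (metis of_nat_less_iff of_nat_numeral of_nat_power)
  then have le: "(2::real) ^ (s * B) \<le> 2 * log 2 m" using L2 by linarith
  have "(2::real) ^ s = (2 ^ (s * B)) powr (1 / B)"
    using Bb b by (simp add: powr_realpow[symmetric] powr_powr)
  also have "\<dots> \<le> (2 * log 2 m) powr (1 / B)" using le by (intro powr_mono2) auto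
  also have "\<dots> = 2 powr (1 / B) * log 2 m powr (1 / B)" by (rule powr_mult)
  also have "\<dots> \<le> 2 powr 1 * log 2 m powr (2 / b)"
    using Bb b b2 \<ell> by (intro mult_mono powr_mono) (auto simp: field_simps)
  also have "log 2 m powr (2 / b) = ((log 2 m)\<^sup>2) powr (1 / b)"
    using \<ell> by (simp add: powr_powr flip: powr_numeral)
  finally show ?thesis by (simp add: s)
qed

text \<open>The factor 10 * \<beta> covers 1 for the accepted columns, 4 * \<beta> for the rejected
  ones of low degree, and 3 * \<beta> for those of high degree. The successor of \<open>r\<close>
  supplies the 2 ^ B by which \<beta> ^ B has to exceed the degrees.\<close>

lemma greedy_quality:
  fixes S :: "nat \<Rightarrow> nat set" and b C :: real
  assumes g: "greedy (2 ^ (Suc r + \<sigma>)) B E c n u {..<n} F" and E: "\<And>j. E j \<subseteq> {..<m}"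
    and m: "1 \<le> m" and c: "\<And>j. j < n \<Longrightarrow> 0 < c j" and j1: "j1 < n" "c j1 = 1"
    and b: "1 \<le> b" and B: "B = min (m + n) (nat \<lfloor>b\<rfloor>)"
    and L: "m \<le> 2 ^ L" "B > 0 \<longrightarrow> L \<le> 2 ^ (\<sigma> * B)" and C: "0 \<le> C" "C \<le> 2 ^ r"
    and x: "\<And>j. j < n \<Longrightarrow> 0 \<le> x j \<and> x j \<le> 1"
    and Ax: "\<And>i. i < m \<Longrightarrow> (\<Sum>j | j < n \<and> i \<in> E j. x j) \<le> b"
    and H: "H = {j. j < n \<and> C * log 2 m < card (E j)}"
    and heavy: "(\<Sum>j\<in>H. c j) < 1 \<or> (\<Sum>j\<in>H. c j) \<le> (\<Sum>j | j < n \<and> E j = {}. c j)"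
  shows "(\<Sum>j<n. c j * x j) \<le> 10 * 2 ^ (Suc r + \<sigma>) * (\<Sum>j\<in>F. c j)"
proof -
  define \<beta> where "\<beta> = (2::real) ^ (Suc r + \<sigma>)"
  let ?A = "\<Sum>j\<in>F. c j"
  \<comment> \<open>As \<open>B\<close> is capped, b / B may be arbitrarily large. Row sums of
    \<open>x\<close> never exceed \<open>n\<close>, so the bound of the linear program can be capped
    in the same way.\<close>
  define b' where "b' = min b (m + n)"
  have \<beta>: "\<beta> \<ge> 1" unfolding \<beta>_def by (rule one_le_power) simp
  have B1: "B \<ge> 1" using b B m le_nat_floor[of 1 b] by auto
  have b': "0 \<le> b'" "b' \<le> 2 * B"
  proof -
    show "0 \<le> b'" using b by (simp add: b'_def)
    have "b < nat \<lfloor>b\<rfloor> + 1" "nat \<lfloor>b\<rfloor> \<ge> 1" using b le_nat_floor[of 1 b] by (linarith, simp)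
    then show "b' \<le> 2 * B" using B by (cases "m + n \<le> nat \<lfloor>b\<rfloor>") (auto simp: b'_def)
  qed
  have F: "F \<subseteq> {..<n}" using greedy_subset[OF g] by simp
  then have finF: "finite F" by (rule finite_subset) simp
  have A0: "?A \<ge> 0" using F c by (intro sum_nonneg) (auto intro: less_imp_le)
  have finH: "finite H" "H \<subseteq> {..<n}" using H by auto
  \<comment> \<open>The chain is C * log 2 m \<le> 2 ^ r * L \<le> 2 ^ (r + \<sigma> * B); as B
    \<ge> 1, the exponent \<open>r\<close> may be charged B times.\<close>
  have light: "card (E j) * 2 ^ B \<le> \<beta> ^ B" if "j < n" "j \<notin> H" for j
  proof -
    have "log 2 m \<le> L"
    proof -
      have "real m \<le> 2 ^ L" using L(1) by (metis of_nat_le_iff of_nat_numeral of_nat_power)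
      then show ?thesis using m by (simp add: log_le_iff powr_realpow)
    qed
    also have "real L \<le> real (2 ^ (\<sigma> * B))" using L(2) B1 by (subst of_nat_le_iff) simp
    also have "\<dots> = 2 ^ (\<sigma> * B)" by simp
    finally have "C * log 2 m \<le> 2 ^ r * 2 ^ (\<sigma> * B)" using C m by (intro mult_mono) auto
    then have "real (card (E j)) * 2 ^ B \<le> 2 ^ r * 2 ^ (\<sigma> * B) * 2 ^ B"
      using that H by (intro mult_right_mono) auto
    also have "\<dots> = 2 ^ (r + \<sigma> * B + B)" by (simp add: power_add)
    also have "\<dots> \<le> 2 ^ ((Suc r + \<sigma>) * B)"
    proof (rule power_increasing)
      have "r * 1 \<le> r * B" by (rule mult_le_mono2[OF B1])
      then show "r + \<sigma> * B + B \<le> (Suc r + \<sigma>) * B" unfolding distrib_right mult_Suc by linarith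
    qed simp
    finally show ?thesis by (simp only: \<beta>_def power_mult of_nat_mult of_nat_power of_nat_numeral)
  qed
  note g = g[folded \<beta>_def]
  have Ax': "(\<Sum>j | j < n \<and> i \<in> E j. x j) \<le> b'" if "i < m" for i
  proof -
    have "(\<Sum>j | j < n \<and> i \<in> E j. x j) \<le> (\<Sum>j | j < n \<and> i \<in> E j. 1)"
      using x by (intro sum_mono) auto
    also have "\<dots> \<le> n" using card_mono[of "{..<n}" "{j. j < n \<and> i \<in> E j}"] by auto
    finally show ?thesis using Ax[OF that] by (simp add: b'_def)
  qed
  have "(\<Sum>j<n. c j * x j) \<le> (1 + 2 * b' * \<beta> / B) * ?A + (\<Sum>j\<in>H. c j * x j)"
    by (rule greedy_bound[OF g \<beta> c E light x Ax' b'(1) B1 finH(2)])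
  also have "(1 + 2 * b' * \<beta> / B) * ?A \<le> (1 + 4 * \<beta>) * ?A"
  proof (intro mult_right_mono A0 add_left_mono)
    have "b' * \<beta> \<le> 2 * B * \<beta>" using b' \<beta> by (intro mult_right_mono) auto
    then show "2 * b' * \<beta> / B \<le> 4 * \<beta>" using B1 by (simp add: field_simps)
  qed
  also have "(\<Sum>j\<in>H. c j * x j) \<le> (\<Sum>j\<in>H. c j)"
    using x c finH by (intro sum_mono mult_left_le) (auto intro: less_imp_le)
  also have "(\<Sum>j\<in>H. c j) \<le> 3 * \<beta> * ?A"
    using heavy
  proof
    assume "(\<Sum>j\<in>H. c j) \<le> (\<Sum>j | j < n \<and> E j = {}. c j)"
    also have "\<dots> \<le> ?A"
      using greedy_empty_column[OF g] F c finF by (intro sum_mono2) (auto intro: less_imp_le)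
    also have "\<dots> \<le> 3 * \<beta> * ?A" using mult_right_mono[of 1 "3 * \<beta>" ?A] \<beta> A0 by simp
    finally show ?thesis .
  next
    assume less: "(\<Sum>j\<in>H. c j) < 1"
    have "j1 \<notin> H"
    proof
      assume "j1 \<in> H"
      then have "c j1 \<le> (\<Sum>j\<in>H. c j)"
        using c finH by (intro member_le_sum) (auto intro: less_imp_le)
      then show False using less j1 by simp
    qed
    \<comment> \<open>The unit vector of a column of value 1 obeys all row constraints with bound 1.
      The dual argument for it yields 1 \<le> 3 * \<beta> * ?A, which pays for a total below
      1.\<close>
    have "(\<Sum>j<n. c j * of_bool (j = j1)) \<le> (1 + 2 * 1 * \<beta> / B) * ?A + (\<Sum>j\<in>H. c j * of_bool (j = j1))"
    proof (rule greedy_bound[OF g \<beta> c E light])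
      fix i
      have "(\<Sum>j | j < n \<and> i \<in> E j. of_bool (j = j1)) \<le> (\<Sum>j<n. of_bool (j = j1) :: real)"
        by (intro sum_mono2) auto
      also have "\<dots> = 1" using j1 by (simp add: of_bool_def)
      finally show "(\<Sum>j | j < n \<and> i \<in> E j. of_bool (j = j1)) \<le> (1::real)" .
    qed (use B1 finH in auto)
    also have "(\<Sum>j\<in>H. c j * of_bool (j = j1)) = 0" using \<open>j1 \<notin> H\<close> by (intro sum.neutral) auto
    also have "(\<Sum>j<n. c j * of_bool (j = j1)) = 1" using j1 by (simp add: of_bool_def if_distrib cong: if_cong)
    finally have "1 \<le> (1 + 2 * \<beta> / B) * ?A" by simp
    also have "\<dots> \<le> 3 * \<beta> * ?A"
    proof (intro mult_right_mono A0)
      have "2 * \<beta> / B \<le> 2 * \<beta> / 1" using B1 \<beta> by (intro divide_left_mono) auto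
      then show "1 + 2 * \<beta> / B \<le> 3 * \<beta>" using \<beta> by simp
    qed
    finally show ?thesis using less by simp
  qed
  also have "(1 + 4 * \<beta>) * ?A + 3 * \<beta> * ?A = (1 + 7 * \<beta>) * ?A" by (simp add: algebra_simps)
  also have "\<dots> \<le> 10 * \<beta> * ?A" using \<beta> A0 by (intro mult_right_mono) auto
  finally show ?thesis by (simp only: \<beta>_def)
qed

definition support_matrix :: "nat \<Rightarrow> nat \<Rightarrow> (nat \<Rightarrow> nat set) \<Rightarrow> real mat" where
  "support_matrix m n S = mat m n (\<lambda>(i, j). if j \<in> S i then 1 else 0)"

lemma random_matrix_eq: "random_matrix m n k = map_pmf (support_matrix m n) (supports_pmf m n k)"
  by (simp add: random_matrix_def supports_pmf_def support_matrix_def[abs_def])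

lemma support_matrix_mult_vec:
  assumes "x \<in> carrier_vec n" "i < m"
  shows "(support_matrix m n S *\<^sub>v x) $ i = (\<Sum>j | j < n \<and> j \<in> S i. x $ j)"
proof -
  have "(support_matrix m n S *\<^sub>v x) $ i = (\<Sum>j<n. (if j \<in> S i then 1 else 0) * x $ j)"
    using assms by (simp add: support_matrix_def scalar_prod_def lessThan_atLeast0)
  also have "\<dots> = (\<Sum>j<n. if j \<in> S i then x $ j else 0)" by (intro sum.cong) auto
  finally show ?thesis by (simp add: sum.If_cases Int_def)
qed

text \<open>The deterministic part: the randomness of the matrix is condensed in the assumption
  \<open>heavy\<close>, and every tape \<open>w\<close> is covered. The 40 is 10 from the greedy
  bound times 4 from rounding the base.\<close>

lemma rounding_quality:
  fixes b C p :: real and c :: "real vec"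
  assumes m: "2 \<le> m" and n: "n > 0" and b: "1 \<le> b" and c: "c \<in> carrier_vec n" "\<And>j. j < n \<Longrightarrow> 0 < c $ j"
    and j1: "j1 < n" "c $ j1 = 1" and C: "0 \<le> C" "C \<le> 2 ^ r"
    and x: "lp_feasible (support_matrix m n S) b x"
    and H: "H = {j. j < n \<and> C * log 2 m < card (column_of m S j)}"
    and heavy: "(\<Sum>j\<in>H. c $ j) < 1 \<or> (\<Sum>j\<in>H. c $ j) \<le> (\<Sum>j | j < n \<and> column_of m S j = {}. c $ j)"
  shows "\<exists>t y. rounds (rounding_com (Suc r)) (support_matrix m n S) b c x w t y \<and>
    linf_norm (support_matrix m n S *\<^sub>v y) \<le> b \<and>
    c \<bullet> y \<ge> 1 / (40 * 2 ^ Suc r) * ((c \<bullet> x) / (max (p * log 2 m) ((log 2 m)\<^sup>2)) powr (1 / b))"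
proof -
  let ?A = "support_matrix m n S"
  define B where "B = min (m + n) (nat \<lfloor>b\<rfloor>)"
  let ?E = "\<lambda>j. {i. i < m \<and> j < n \<and> 0 < ?A $$ (i, j)}" and ?c = "\<lambda>j. if j < n then c $ j else 0"
  have A: "?A \<in> carrier_mat m n" by (simp add: support_matrix_def)
  obtain t L \<sigma> u F where r: "rounds (rounding_com (Suc r)) ?A b c x w t (vec n (\<lambda>j. of_bool (j \<in> F)))"
    and L: "m \<le> 2 ^ L" "L \<le> m" "L > 0 \<longrightarrow> 2 ^ (L - 1) < m" "B > 0 \<longrightarrow> L \<le> 2 ^ (\<sigma> * B)"
      "\<sigma> > 0 \<longrightarrow> 2 ^ ((\<sigma> - 1) * B) < L"
    and g: "greedy (2 ^ (Suc r + \<sigma>)) B ?E ?c n u {..<n} F"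
    using rounding_com_rounds[OF A c(1) B_def, where r = "Suc r" and x = x and w = w] by blast
  let ?y = "vec n (\<lambda>j. of_bool (j \<in> F) :: real)"
  have E: "?E j = column_of m S j" if "j < n" for j
    using that by (auto simp: support_matrix_def column_of_def split: if_splits)
  have F: "F \<subseteq> {..<n}" using greedy_subset[OF g] by simp
  have B: "B \<le> b" using b by (auto simp: B_def min_def) linarith+
  have dims: "dim_row ?A = m" "dim_col ?A = n" by (simp_all add: support_matrix_def)
  have xc: "x \<in> carrier_vec n" using x by (simp add: lp_feasible_def dims)
  have x01: "0 \<le> x $ j \<and> x $ j \<le> 1" if "j < n" for j
  proof -
    have "x $ j \<in> set\<^sub>v x" using xc that by (auto simp: vec_set_def)
    then show ?thesis using x by (auto simp: lp_feasible_def)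
  qed
  have rowE: "{j. j < n \<and> i \<in> ?E j} = {j. j < n \<and> j \<in> S i}" if "i < m" for i
    using that by (auto simp: support_matrix_def split: if_splits)
  have Ax: "(\<Sum>j | j < n \<and> i \<in> ?E j. x $ j) \<le> b" if "i < m" for i
  proof -
    have "(?A *\<^sub>v x) $ i \<le> (b \<cdot>\<^sub>v all_ones m) $ i"
      using x that by (simp add: lp_feasible_def less_eq_vec_def dims all_ones_def)
    moreover have "(b \<cdot>\<^sub>v all_ones m) $ i = b" using that by (simp add: all_ones_def)
    moreover have "(?A *\<^sub>v x) $ i = (\<Sum>j | j < n \<and> i \<in> ?E j. x $ j)"
      unfolding rowE[OF that] by (rule support_matrix_mult_vec[OF xc that])
    ultimately show ?thesis by simp
  qed
  have cy: "c \<bullet> ?y = (\<Sum>j\<in>F. ?c j)"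
  proof -
    have "c \<bullet> ?y = (\<Sum>j<n. if j \<in> F then ?c j else 0)"
      unfolding scalar_prod_def lessThan_atLeast0 by (intro sum.cong) auto
    also have "\<dots> = (\<Sum>j\<in>{..<n} \<inter> F. ?c j)" by (simp add: sum.If_cases)
    also have "{..<n} \<inter> F = F" using F by blast
    finally show ?thesis .
  qed
  have cx: "c \<bullet> x = (\<Sum>j<n. ?c j * x $ j)"
    using xc unfolding scalar_prod_def lessThan_atLeast0 by (intro sum.cong) auto
  have sumc: "(\<Sum>j | j < n \<and> Q j. ?c j) = (\<Sum>j | j < n \<and> Q j. c $ j)" for Q by (intro sum.cong) auto
  have OPT: "c \<bullet> x \<le> 10 * 2 ^ (Suc r + \<sigma>) * (c \<bullet> ?y)"
    unfolding cx cy
  proof (rule greedy_quality[OF g _ _ _ _ _ b B_def L(1) L(4) C x01 Ax])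
    show "H = {j. j < n \<and> C * log 2 m < card (?E j)}" unfolding H using E by (intro Collect_cong) auto
    have "{j. j < n \<and> ?E j = {}} = {j. j < n \<and> column_of m S j = {}}" using E by (intro Collect_cong) auto
    then show "(\<Sum>j\<in>H. ?c j) < 1 \<or> (\<Sum>j\<in>H. ?c j) \<le> (\<Sum>j | j < n \<and> ?E j = {}. ?c j)"
      using heavy unfolding H by (simp only: sumc)
  qed (use m c(2) j1 in auto)
  let ?D = "(max (p * log 2 m) ((log 2 m)\<^sup>2)) powr (1 / b)"
  have "log 2 m \<ge> 1" using m by simp
  then have "(log 2 m)\<^sup>2 \<ge> 1" by (rule one_le_power)
  then have "max (p * log 2 m) ((log 2 m)\<^sup>2) > 0" by simp
  then have D: "((log 2 m)\<^sup>2) powr (1 / b) \<le> ?D" "?D > 0"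
    using b by (auto intro!: powr_mono2)
  have y0: "c \<bullet> ?y \<ge> 0" unfolding cy using F c by (intro sum_nonneg) (auto intro: less_imp_le)
  have "2 ^ \<sigma> \<le> 4 * ?D"
    using log_base_bound[OF m b B_def L(2,3,5)] D by simp
  then have "10 * 2 ^ Suc r * 2 ^ \<sigma> * (c \<bullet> ?y) \<le> 10 * 2 ^ Suc r * (4 * ?D) * (c \<bullet> ?y)"
    using y0 by (intro mult_right_mono mult_left_mono) auto
  moreover have "10 * 2 ^ (Suc r + \<sigma>) * (c \<bullet> ?y) = 10 * 2 ^ Suc r * 2 ^ \<sigma> * (c \<bullet> ?y)"
    by (simp add: power_add)
  moreover have "10 * 2 ^ Suc r * (4 * ?D) * (c \<bullet> ?y) = 40 * 2 ^ Suc r * (c \<bullet> ?y) * ?D" by simp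
  ultimately have "c \<bullet> x \<le> 40 * 2 ^ Suc r * (c \<bullet> ?y) * ?D" using OPT by linarith
  then have "1 / (40 * 2 ^ Suc r) * ((c \<bullet> x) / ?D) \<le> c \<bullet> ?y"
    using D by (simp add: field_simps)
  moreover have "\<bar>(?A *\<^sub>v ?y) $ i\<bar> \<le> b" if i: "i < m" for i
  proof -
    have "(?A *\<^sub>v ?y) $ i = (\<Sum>j | j < n \<and> j \<in> S i. ?y $ j)"
      using i by (intro support_matrix_mult_vec) auto
    also have "\<dots> = (\<Sum>j | j < n \<and> j \<in> S i. of_bool (j \<in> F))" by (intro sum.cong) auto
    finally have Ay: "(?A *\<^sub>v ?y) $ i = (\<Sum>j | j < n \<and> j \<in> S i. of_bool (j \<in> F))" .
    also have "\<dots> = card {j\<in>F. i \<in> ?E j}"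
    proof -
      have "{j\<in>F. i \<in> ?E j} = {j. j < n \<and> j \<in> S i} \<inter> F" using F i by (auto simp: support_matrix_def split: if_splits)
      then show ?thesis by (simp add: Int_def)
    qed
    also have "\<dots> \<le> B" using greedy_load[OF g, of i] by simp
    finally have "(?A *\<^sub>v ?y) $ i \<le> B" "(?A *\<^sub>v ?y) $ i \<ge> 0"
      using Ay by (auto intro: sum_nonneg)
    then show ?thesis using B by simp
  qed
  then have "linf_norm (?A *\<^sub>v ?y) \<le> b"
    unfolding linf_norm_def using b by (intro Max.boundedI) (auto simp: dims)
  ultimately show ?thesis using r by blast
qed

text \<open>High probability means 1 - m powr (- \<gamma>) for a prescribed \<gamma>, on which
  program, time bound and constant may depend. The function \<open>X\<close> lets the optimum vary
  with the matrix, but not with the coins.\<close>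

theorem theorem3:
  fixes \<gamma> :: real
  assumes "\<gamma> > 0"
  shows "\<exists>P T \<delta>. polynomially_bounded T \<and> rounding_in_time P T \<and> (\<delta>::real) > 0 \<and>
    (\<forall>(m::nat) (n::nat) (k::nat) (b::real) (p::real) (c::real vec) (X::real mat \<Rightarrow> real vec).
       1 \<le> m \<longrightarrow> 1 \<le> k \<longrightarrow> k \<le> n \<longrightarrow> 1 \<le> b \<longrightarrow> 1 \<le> p \<longrightarrow>
       c \<in> carrier_vec n \<longrightarrow> Max ((\<lambda>i. c $ i) ` {..<n}) = 1 \<longrightarrow> (\<forall>i<n. c $ i \<ge> 1 / p) \<longrightarrow>
       real m \<le> real n * log 2 (real m) / real k \<longrightarrow>
       (\<forall>A \<in> set_pmf (random_matrix m n k). lp_optimal A b c (X A)) \<longrightarrow>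
       measure_pmf.prob (pair_pmf (random_matrix m n k) (coin_tosses (T m n)))
         {(A, w). \<exists>t y. rounds P A b c (X A) w t y \<and>
            linf_norm (A *\<^sub>v y) \<le> b \<and>
            c \<bullet> y \<ge> \<delta> * ((c \<bullet> X A) /
              (max (p * log 2 (real m)) ((log 2 (real m))\<^sup>2)) powr (1 / b))}
       \<ge> 1 - real m powr (- \<gamma>))"
proof -
  define C where "C = 10 + 2 * \<gamma>"
  \<comment> \<open>The base of the prices is a power of two, so the degree limit enters it through
    one.\<close>
  obtain r where r: "C < 2 ^ r" using real_arch_pow[of 2 C] by auto
  have C0: "0 \<le> C" "C \<le> 2 ^ r" using assms r by (auto simp: C_def)
  show ?thesis
  proof (intro exI[of _ "rounding_com (Suc r)"] exI[of _ "time_bound (Suc r)"]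
      exI[of _ "1 / (40 * 2 ^ Suc r)"] conjI allI impI
      polynomially_bounded_time_bound rounding_in_time_rounding_com)
    fix m n k :: nat and b p :: real and c :: "real vec" and X :: "real mat \<Rightarrow> real vec"
    assume m1: "1 \<le> m" and k: "1 \<le> k" "k \<le> n" and b: "1 \<le> b" and p: "1 \<le> p"
      and c: "c \<in> carrier_vec n" and max: "Max ((\<lambda>i. c $ i) ` {..<n}) = 1" and cp: "\<forall>i<n. c $ i \<ge> 1 / p"
      and mn: "real m \<le> real n * log 2 (real m) / real k"
      and X: "\<forall>A \<in> set_pmf (random_matrix m n k). lp_optimal A b c (X A)"
    let ?M = "random_matrix m n k" and ?W = "coin_tosses (time_bound (Suc r) m n)"
    let ?good = "\<lambda>A w. \<exists>t y. rounds (rounding_com (Suc r)) A b c (X A) w t y \<and>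
            linf_norm (A *\<^sub>v y) \<le> b \<and>
            c \<bullet> y \<ge> 1 / (40 * 2 ^ Suc r) * ((c \<bullet> X A) /
              (max (p * log 2 (real m)) ((log 2 (real m))\<^sup>2)) powr (1 / b))"
    have m: "2 \<le> m"
    proof (rule ccontr)
      assume "\<not> 2 \<le> m"
      then have "m = 1" using m1 by simp
      then show False using mn by simp
    qed
    have n: "n > 0" using k by simp
    have c01: "0 < c $ j \<and> c $ j \<le> 1" if "j < n" for j
    proof
      have "0 < 1 / p" using p by simp
      also have "\<dots> \<le> c $ j" using cp that by simp
      finally show "0 < c $ j" .
      show "c $ j \<le> 1" unfolding max[symmetric] using that by (intro Max_ge) auto
    qed
    obtain j1 where j1: "j1 < n" "c $ j1 = 1"
      using Max_in[of "(\<lambda>i. c $ i) ` {..<n}"] n unfolding max by fastforce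
    let ?h = "\<lambda>S. \<Sum>j | j < n \<and> C * log 2 m < card (column_of m S j). c $ j"
    let ?light = "{S. ?h S < 1 \<or> ?h S \<le> (\<Sum>j | j < n \<and> column_of m S j = {}. c $ j)}"
    have "1 - m powr (-\<gamma>) \<le> measure_pmf.prob (supports_pmf m n k) ?light"
      by (rule prob_heavy_columns[OF k m mn c01 assms C_def])
    \<comment> \<open>Optimality of \<open>X\<close> is known on the support only.\<close>
    also have "\<dots> = measure_pmf.prob (supports_pmf m n k) (?light \<inter> set_pmf (supports_pmf m n k))"
      by (simp add: measure_Int_set_pmf)
    also have "\<dots> \<le> measure_pmf.prob (supports_pmf m n k) (support_matrix m n -` {A. \<forall>w. ?good A w})"
    proof (intro measure_pmf.finite_measure_mono subsetI vimageI2 CollectI allI)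
      fix S w assume S: "S \<in> ?light \<inter> set_pmf (supports_pmf m n k)"
      then have "support_matrix m n S \<in> set_pmf ?M" by (simp add: random_matrix_eq)
      then have "lp_feasible (support_matrix m n S) b (X (support_matrix m n S))"
        using X by (auto simp: lp_optimal_def)
      from rounding_quality[OF m n b c conjunct1[OF c01] j1 C0 this refl] S
      show "?good (support_matrix m n S) w" by simp
    qed auto
    also have "\<dots> = measure_pmf.prob ?M {A. \<forall>w. ?good A w}"
      by (simp add: random_matrix_eq)
    \<comment> \<open>Quantified over all tapes, the event depends on the matrix alone; its preimage
      under the projection lies in the joint event.\<close>
    also have "\<dots> = measure_pmf.prob (map_pmf fst (pair_pmf ?M ?W)) {A. \<forall>w. ?good A w}"
      by (simp only: map_fst_pair_pmf)
    also have "\<dots> = measure_pmf.prob (pair_pmf ?M ?W) (fst -` {A. \<forall>w. ?good A w})"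
      by (rule measure_map_pmf)
    also have "\<dots> \<le> measure_pmf.prob (pair_pmf ?M ?W) {(A, w). ?good A w}"
      by (intro measure_pmf.finite_measure_mono) auto
    finally show "1 - m powr (-\<gamma>) \<le> measure_pmf.prob (pair_pmf ?M ?W) {(A, w). ?good A w}" .
  qed simp
qed

end
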